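(* Assume $\inf_{x\in\mathbb R}V''(x)>0$. Then for every integer $n\ge1$, $$n\,\inf_{x\in\mathbb R}V''(x)\ \le\ \lambda_n(-L)\ \le\ n\,\sup_{x\in\mathbb R}V''(x),$$ with the right-hand side equal to $+\infty$ if $V''$ is unbounded from above.
   Context: $V\in C^\infty(\mathbb R)$, $\mu$ the probability measure with density proportional to $e^{-V}$, and $Lf=f''-V'f'$, regarded as a self-adjoint operator in $L^2(\mu)$ (unique self-adjoint extension from $C_0^\infty(\mathbb R)$). For $n\ge1$, $\lambda_n(-L)=\sup_{g_0,\dots,g_{n-1}\in L^2(\mu)}\inf_{f\in D(-L)\setminus\{0\},\,f\perp_\mu g_i}\frac{\int f(-Lf)\,d\mu}{\int f^2d\mu}$ (max-min values). *)

theory Defs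
  imports "HOL-Analysis.Analysis"
begin

definition smooth :: "(real \<Rightarrow> real) \<Rightarrow> bool" where
  "smooth f \<longleftrightarrow> (\<forall>k x. ((deriv ^^ k) f) differentiable (at x))"

definition test_fun :: "(real \<Rightarrow> real) \<Rightarrow> bool" where
  "test_fun f \<longleftrightarrow> smooth f \<and> compact (closure {x. f x \<noteq> 0})"

definition mu :: "(real \<Rightarrow> real) \<Rightarrow> real measure" where
  "mu V = density lborel
     (\<lambda>x. ennreal (exp (- V x) / (\<integral>y. exp (- V y) \<partial>lborel)))"

definition L2 :: "(real \<Rightarrow> real) \<Rightarrow> (real \<Rightarrow> real) set" where
  "L2 V = {f. f \<in> borel_measurable borel \<and> integrable (mu V) (\<lambda>x. (f x)\<^sup>2)}"

definition Lop :: "(real \<Rightarrow> real) \<Rightarrow> (real \<Rightarrow> real) \<Rightarrow> real \<Rightarrow> real" where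
  "Lop V f x = deriv (deriv f) x - deriv V x * deriv f x"

text \<open>Graph of the self-adjoint realisation of L in L^2(mu): the closure in L^2(mu)
  of the graph of L restricted to C_0^infinity (L is essentially self-adjoint, so
  this closure is the unique self-adjoint extension). A pair (f,g) belongs to it iff
  f is in the domain and L f = g.\<close>
definition L_graph :: "(real \<Rightarrow> real) \<Rightarrow> ((real \<Rightarrow> real) \<times> (real \<Rightarrow> real)) set" where
  "L_graph V = {(f, g). f \<in> L2 V \<and> g \<in> L2 V \<and>
     (\<exists>\<phi>::nat \<Rightarrow> real \<Rightarrow> real. (\<forall>k. test_fun (\<phi> k)) \<and>
        (\<lambda>k. \<integral>x. (\<phi> k x - f x)\<^sup>2 \<partial>mu V) \<longlonglongrightarrow> 0 \<and>
        (\<lambda>k. \<integral>x. (Lop V (\<phi> k) x - g x)\<^sup>2 \<partial>mu V) \<longlonglongrightarrow> 0)}"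

definition lambda_n :: "(real \<Rightarrow> real) \<Rightarrow> nat \<Rightarrow> ereal" where
  "lambda_n V n =
     (SUP gs \<in> {gs :: nat \<Rightarrow> real \<Rightarrow> real. \<forall>i<n. gs i \<in> L2 V}.
        INF fg \<in> {(f, g). (f, g) \<in> L_graph V \<and> (\<integral>x. (f x)\<^sup>2 \<partial>mu V) \<noteq> 0 \<and>
                   (\<forall>i<n. (\<integral>x. f x * gs i x \<partial>mu V) = 0)}.
          ereal ((\<integral>x. fst fg x * (- snd fg x) \<partial>mu V) / (\<integral>x. (fst fg x)\<^sup>2 \<partial>mu V)))"

end

theory Submission
  imports Defs "HOL-Probability.Sinc_Integral" "HOL-Real_Asymp.Real_Asymp"
begin

text \<open>
  Write \<open>A = d/dx\<close>. Its adjoint in \<open>L\<^sup>2(\<mu>)\<close> is \<open>A* u = V' u - u'\<close>, so that \<open>-L = A* A\<close>, and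
  \<open>A A* = -L + V''\<close> gives \<open>\<parallel>A* u\<parallel>\<^sup>2 = \<parallel>u'\<parallel>\<^sup>2 + \<integral> V'' u\<^sup>2 d\<mu>\<close>. Both bounds are inductions on \<open>n\<close> that
  gain one copy of \<open>inf V''\<close> or \<open>sup V''\<close> per step.

  Lower bound: if \<open>f\<close> is orthogonal to all polynomials of degree less than \<open>n\<close>, then \<open>f = A* u\<close> with
  \<open>u\<close> orthogonal to all polynomials of degree less than \<open>n - 1\<close>. By induction
  \<open>\<parallel>f\<parallel>\<^sup>2 = \<parallel>A* u\<parallel>\<^sup>2 \<ge> n (inf V'') \<parallel>u\<parallel>\<^sup>2\<close>, while \<open>\<parallel>f\<parallel>\<^sup>2 = \<langle>f', u\<rangle> \<le> \<parallel>f'\<parallel> \<parallel>u\<parallel>\<close>; together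
  \<open>\<parallel>f'\<parallel>\<^sup>2 \<ge> n (inf V'') \<parallel>f\<parallel>\<^sup>2\<close>.

  Upper bound: every polynomial \<open>p\<close> of degree at most \<open>n\<close> satisfies \<open>\<parallel>p'\<parallel>\<^sup>2 \<le> n (sup V'') \<parallel>p\<parallel>\<^sup>2\<close>,
  because \<open>q = p'\<close> satisfies \<open>\<parallel>q\<parallel>\<^sup>2 = \<langle>p, A* q\<rangle> \<le> \<parallel>p\<parallel> \<parallel>A* q\<parallel>\<close> and, by induction,
  \<open>\<parallel>A* q\<parallel>\<^sup>2 \<le> n (sup V'') \<parallel>q\<parallel>\<^sup>2\<close>. These polynomials form a space of dimension \<open>n + 1\<close>, so some nonzero
  one is orthogonal to the given \<open>n\<close> functions.
\<close>

section \<open>Integration and linear algebra\<close>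

text \<open>The antiderivative is the integral over the half-line up to \<open>x\<close>. Its
  derivative comes from the fundamental theorem of calculus and its two limits from dominated
  convergence. These limits are the boundary terms of every later integration by parts.\<close>

lemma antiderivative_lborel:
  fixes g :: "real \<Rightarrow> real"
  assumes g: "integrable lborel g" and cont: "continuous_on UNIV g"
  obtains K where "\<And>x. (K has_real_derivative g x) (at x)"
    and "(K \<longlongrightarrow> 0) at_bot" and "(K \<longlongrightarrow> (\<integral>x. g x \<partial>lborel)) at_top"
proof
  define K where "K x = (\<integral>y. indicator {..x} y *\<^sub>R g y \<partial>lborel)" for x
  have si: "set_integrable lborel A g" if "A \<in> sets borel" for A
    unfolding set_integrable_def using integrable_mult_indicator[of A lborel g] that g by simp
  have K_split: "K y = K a + integral {a..y} g" if "a \<le> y" for a y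
  proof -
    have "K y = (LINT x:{..a} \<union> {a<..y}|lborel. g x)"
      using that by (simp add: K_def set_lebesgue_integral_def ivl_disj_un)
    also have "\<dots> = (LINT x:{..a}|lborel. g x) + (LINT x:{a<..y}|lborel. g x)"
      by (rule set_integral_Un) (auto intro: si)
    also have "(LINT x:{a<..y}|lborel. g x) = integral {a<..y} g"
      by (rule set_borel_integral_eq_integral) (auto intro: si)
    also have "\<dots> = integral {a..y} g"
      by (rule integral_spike_set) (auto intro: negligible_subset[of "{a}"])
    finally show ?thesis by (simp add: K_def set_lebesgue_integral_def)
  qed
  show "(K has_real_derivative g x) (at x)" for x
  proof -
    \<comment> \<open>The fundamental theorem is applied on a compact interval having
      \<open>x\<close> in its interior, so that the one-interval derivative becomes a full
      derivative.\<close>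
    have "((\<lambda>y. K (x - 1) + integral {x - 1..y} g) has_real_derivative g x) (at x within {x - 1..x + 1})"
      by (auto intro!: derivative_eq_intros integral_has_real_derivative continuous_on_subset[OF cont])
    then have "(K has_real_derivative g x) (at x within {x - 1..x + 1})"
      by (rule has_field_derivative_transform_within[OF _ zero_less_one])
         (auto simp: dist_real_def intro!: K_split[symmetric])
    then show ?thesis
      by (simp add: at_within_Icc_at)
  qed
  show "(K \<longlongrightarrow> (\<integral>x. g x \<partial>lborel)) at_top"
    unfolding K_def by (rule tendsto_integral_at_top) (auto intro: g)
  have "((\<lambda>t. \<integral>y. indicator {..- t} y *\<^sub>R g y \<partial>lborel) \<longlongrightarrow> (\<integral>y. 0 \<partial>(lborel::real measure))) at_top"
  proof (rule integral_dominated_convergence_at_top[where w="\<lambda>x. norm (g x)"])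
    have [measurable]: "g \<in> borel_measurable borel" using g by auto
    show "(\<lambda>y. indicator {..- t} y *\<^sub>R g y) \<in> borel_measurable lborel" for t by measurable
    have "((\<lambda>i. indicat_real {..- i} x *\<^sub>R g x) \<longlongrightarrow> 0) at_top" for x
    proof (rule tendsto_eventually)
      show "\<forall>\<^sub>F i in at_top. indicat_real {..- i} x *\<^sub>R g x = 0"
        using eventually_gt_at_top[of "-x"] by eventually_elim auto
    qed
    then show "AE x in lborel. ((\<lambda>i. indicat_real {..- i} x *\<^sub>R g x) \<longlongrightarrow> 0) at_top" by simp
  qed (use g in \<open>auto split: split_indicator\<close>)
  then show "(K \<longlongrightarrow> 0) at_bot"
    by (simp add: filterlim_at_bot_mirror K_def)
qed

lemma integrable_inverse_1_plus_square_lborel: "integrable lborel (\<lambda>x::real. inverse (1 + x\<^sup>2))"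
  using integrable_inverse_1_plus_square by (simp add: set_integrable_def)

text \<open>Gaussian elimination by induction on the set of equations. It later yields a nonzero
  polynomial subject to fewer orthogonality conditions than it has coefficients.\<close>

lemma homogeneous_system_nontrivial_solution:
  fixes a :: "'i \<Rightarrow> 'j \<Rightarrow> 'a::field"
  assumes "finite I" "finite J" "card I < card J"
  shows "\<exists>c. (\<exists>j\<in>J. c j \<noteq> 0) \<and> (\<forall>i\<in>I. (\<Sum>j\<in>J. c j * a i j) = 0)"
  using assms
proof (induction I arbitrary: J a rule: finite_induct)
  case empty
  then have "J \<noteq> {}" by auto
  then show ?case by (auto intro!: exI[of _ "\<lambda>_. 1"])
next
  case (insert i0 I)
  show ?case
  proof (cases "\<forall>j\<in>J. a i0 j = 0")
    case True
    moreover have "card I < card J" using insert.prems insert.hyps by simp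
    then obtain c where "\<exists>j\<in>J. c j \<noteq> 0" "\<forall>i\<in>I. (\<Sum>j\<in>J. c j * a i j) = 0"
      using insert.IH[of J a] insert.prems by blast
    ultimately show ?thesis by (intro exI[of _ c]) simp
  next
    case False
    then obtain p where p: "p \<in> J" "a i0 p \<noteq> 0" by auto
    \<comment> \<open>If \<open>p\<close> is a pivot of equation \<open>i0\<close>, subtracting a
      multiple of that equation from the others eliminates the unknown \<open>p\<close>.\<close>
    define b where "b i j = a i j - a i0 j / a i0 p * a i p" for i j
    have "card I < card (J - {p})" using insert.prems insert.hyps p by simp
    then obtain c where c: "\<exists>j\<in>J - {p}. c j \<noteq> 0"
      and c0: "\<And>i. i \<in> I \<Longrightarrow> (\<Sum>j\<in>J - {p}. c j * b i j) = 0"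
      using insert.IH[of "J - {p}" b] insert.prems by blast
    define s where "s = (\<Sum>j\<in>J - {p}. c j * a i0 j)"
    \<comment> \<open>The pivot coordinate is recovered by solving equation \<open>i0\<close> for
      it.\<close>
    define d where "d = c(p := - s / a i0 p)"
    have sum_d: "(\<Sum>j\<in>J. d j * a i j) = (\<Sum>j\<in>J - {p}. c j * a i j) - s / a i0 p * a i p" for i
      using p insert.prems by (subst sum.remove[of J p]) (auto simp: d_def intro!: sum.cong)
    have b_sum: "(\<Sum>j\<in>J - {p}. c j * b i j) = (\<Sum>j\<in>J - {p}. c j * a i j) - s / a i0 p * a i p" for i
    proof -
      have "s / a i0 p * a i p = (\<Sum>j\<in>J - {p}. c j * (a i0 j / a i0 p * a i p))"
        unfolding s_def sum_divide_distrib sum_distrib_right by (simp add: mult.assoc)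
      then show ?thesis
        unfolding b_def right_diff_distrib sum_subtractf by simp
    qed
    show ?thesis
    proof (intro exI[of _ d] conjI ballI)
      show "\<exists>j\<in>J. d j \<noteq> 0" using c by (auto simp: d_def)
      fix i assume "i \<in> insert i0 I"
      then show "(\<Sum>j\<in>J. d j * a i j) = 0"
        using p c0[of i] unfolding sum_d b_sum s_def by auto
    qed
  qed
qed

lemma integrable_mult_of_squares:
  fixes f g :: "'a \<Rightarrow> real"
  assumes [measurable]: "f \<in> borel_measurable M" "g \<in> borel_measurable M"
    and "integrable M (\<lambda>x. (f x)\<^sup>2)" "integrable M (\<lambda>x. (g x)\<^sup>2)"
  shows "integrable M (\<lambda>x. f x * g x)"
proof (rule Bochner_Integration.integrable_bound)
  show "integrable M (\<lambda>x. (f x)\<^sup>2 + (g x)\<^sup>2)" using assms by simp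
  have "\<bar>f x * g x\<bar> \<le> (f x)\<^sup>2 + (g x)\<^sup>2" for x
    using sum_squares_bound[of "\<bar>f x\<bar>" "\<bar>g x\<bar>"]
      zero_le_power2[of "f x"] zero_le_power2[of "g x"] abs_ge_zero[of "f x * g x"]
    unfolding abs_mult power2_abs by linarith
  then show "AE x in M. norm (f x * g x) \<le> norm ((f x)\<^sup>2 + (g x)\<^sup>2)" by simp
qed simp

text \<open>The quadratic form in \<open>s\<close>, \<open>t\<close> given by the integral of (s f -
  t g)^2 is nonnegative; suitable values of \<open>s\<close> and \<open>t\<close> give the
  inequality.\<close>

lemma integral_Cauchy_Schwarz:
  fixes f g :: "'a \<Rightarrow> real"
  assumes [measurable]: "f \<in> borel_measurable M" "g \<in> borel_measurable M"
    and f: "integrable M (\<lambda>x. (f x)\<^sup>2)" and g: "integrable M (\<lambda>x. (g x)\<^sup>2)"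
  shows "(\<integral>x. f x * g x \<partial>M)\<^sup>2 \<le> (\<integral>x. (f x)\<^sup>2 \<partial>M) * (\<integral>x. (g x)\<^sup>2 \<partial>M)"
proof -
  define A B C where "A = (\<integral>x. (f x)\<^sup>2 \<partial>M)" and "B = (\<integral>x. f x * g x \<partial>M)" and "C = (\<integral>x. (g x)\<^sup>2 \<partial>M)"
  note fg = integrable_mult_of_squares[OF assms]
  have quad: "0 \<le> s\<^sup>2 * A - 2 * s * t * B + t\<^sup>2 * C" for s t
  proof -
    have "0 \<le> (\<integral>x. (s * f x - t * g x)\<^sup>2 \<partial>M)" by simp
    also have "\<dots> = (\<integral>x. s\<^sup>2 * (f x)\<^sup>2 - 2 * s * t * (f x * g x) + t\<^sup>2 * (g x)\<^sup>2 \<partial>M)"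
      by (rule Bochner_Integration.integral_cong) (auto simp: power2_eq_square algebra_simps)
    also have "\<dots> = s\<^sup>2 * A - 2 * s * t * B + t\<^sup>2 * C"
      using f g fg by (simp add: A_def B_def C_def)
    finally show ?thesis .
  qed
  have "0 \<le> C" by (simp add: C_def)
  show ?thesis
  proof (cases "C = 0")
    case False
    \<comment> \<open>This is the form at s = C, t = B.\<close>
    have "0 \<le> C\<^sup>2 * A - 2 * C * B * B + B\<^sup>2 * C" by (rule quad)
    also have "\<dots> = C * (A * C - B\<^sup>2)" by (simp add: power2_eq_square algebra_simps)
    finally show ?thesis
      using False \<open>0 \<le> C\<close> by (auto simp: zero_le_mult_iff simp flip: A_def B_def C_def)
  next
    case True
    have "B = 0"
      \<comment> \<open>For C = 0 and nonzero B this choice gives the value A - (A + 1) = -1, a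
        contradiction.\<close>
      using quad[of 1 "(A + 1) / (2 * B)"] True by (cases "B = 0") auto
    then show ?thesis by (simp add: A_def B_def C_def)
  qed
qed

text \<open>Expand FG - fg as (F - f)(G - g) + f(G - g) + (F - f)g and apply Cauchy-Schwarz to each
  term. It carries quadratic expressions from test functions to their \<open>L\<^sup>2\<close>
  limits.\<close>

lemma tendsto_integral_mult_L2:
  fixes f g :: "'a \<Rightarrow> real" and F G :: "nat \<Rightarrow> 'a \<Rightarrow> real"
  assumes [measurable]: "f \<in> borel_measurable M" "g \<in> borel_measurable M"
      "\<And>k. F k \<in> borel_measurable M" "\<And>k. G k \<in> borel_measurable M"
    and f: "integrable M (\<lambda>x. (f x)\<^sup>2)" and g: "integrable M (\<lambda>x. (g x)\<^sup>2)"
    and F: "\<And>k. integrable M (\<lambda>x. (F k x)\<^sup>2)" and G: "\<And>k. integrable M (\<lambda>x. (G k x)\<^sup>2)"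
    and lim: "(\<lambda>k. \<integral>x. (F k x - f x)\<^sup>2 \<partial>M) \<longlonglongrightarrow> 0" "(\<lambda>k. \<integral>x. (G k x - g x)\<^sup>2 \<partial>M) \<longlonglongrightarrow> 0"
  shows "(\<lambda>k. \<integral>x. F k x * G k x \<partial>M) \<longlonglongrightarrow> (\<integral>x. f x * g x \<partial>M)"
proof -
  have diff2: "integrable M (\<lambda>x. (u x - v x)\<^sup>2)"
    if [measurable]: "u \<in> borel_measurable M" "v \<in> borel_measurable M"
    and "integrable M (\<lambda>x. (u x)\<^sup>2)" "integrable M (\<lambda>x. (v x)\<^sup>2)" for u v :: "'a \<Rightarrow> real"
    using that integrable_mult_of_squares[OF that] by (simp add: power2_diff mult.assoc)
  note dF = diff2[OF _ _ F f] and dG = diff2[OF _ _ G g]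
  have cs0: "(\<lambda>k. \<integral>x. u k x * v k x \<partial>M) \<longlonglongrightarrow> 0"
    if [measurable]: "\<And>k. u k \<in> borel_measurable M" "\<And>k. v k \<in> borel_measurable M"
    and "\<And>k. integrable M (\<lambda>x. (u k x)\<^sup>2)" "\<And>k. integrable M (\<lambda>x. (v k x)\<^sup>2)"
    and l: "(\<lambda>k. (\<integral>x. (u k x)\<^sup>2 \<partial>M) * (\<integral>x. (v k x)\<^sup>2 \<partial>M)) \<longlonglongrightarrow> 0" for u v :: "nat \<Rightarrow> 'a \<Rightarrow> real"
  proof -
    have "(\<lambda>k. (\<integral>x. u k x * v k x \<partial>M)\<^sup>2) \<longlonglongrightarrow> 0"
      by (rule tendsto_sandwich[OF _ _ tendsto_const l]) (simp_all add: integral_Cauchy_Schwarz that(1-4))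
    then show ?thesis by simp
  qed
  have "(\<lambda>k. (\<integral>x. (F k x - f x) * (G k x - g x) \<partial>M) + (\<integral>x. f x * (G k x - g x) \<partial>M)
      + (\<integral>x. (F k x - f x) * g x \<partial>M) + (\<integral>x. f x * g x \<partial>M)) \<longlonglongrightarrow> 0 + 0 + 0 + (\<integral>x. f x * g x \<partial>M)"
  proof (intro tendsto_add tendsto_const cs0)
    show "(\<lambda>k. (\<integral>x. (F k x - f x)\<^sup>2 \<partial>M) * (\<integral>x. (G k x - g x)\<^sup>2 \<partial>M)) \<longlonglongrightarrow> 0"
      using tendsto_mult[OF lim] by simp
    show "(\<lambda>k. (\<integral>x. (f x)\<^sup>2 \<partial>M) * (\<integral>x. (G k x - g x)\<^sup>2 \<partial>M)) \<longlonglongrightarrow> 0"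
      using tendsto_mult_right_zero[OF lim(2)] by simp
    show "(\<lambda>k. (\<integral>x. (F k x - f x)\<^sup>2 \<partial>M) * (\<integral>x. (g x)\<^sup>2 \<partial>M)) \<longlonglongrightarrow> 0"
      using tendsto_mult_left_zero[OF lim(1)] by simp
  qed (simp_all add: dF dG f g)
  moreover have "(\<integral>x. (F k x - f x) * (G k x - g x) \<partial>M) + (\<integral>x. f x * (G k x - g x) \<partial>M)
      + (\<integral>x. (F k x - f x) * g x \<partial>M) + (\<integral>x. f x * g x \<partial>M) = (\<integral>x. F k x * G k x \<partial>M)" for k
  proof -
    have "integrable M (\<lambda>x. (F k x - f x) * (G k x - g x))" "integrable M (\<lambda>x. f x * (G k x - g x))"
      "integrable M (\<lambda>x. (F k x - f x) * g x)" "integrable M (\<lambda>x. f x * g x)"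
      by (intro integrable_mult_of_squares; simp add: dF dG f g)+
    then show ?thesis
      by (simp flip: Bochner_Integration.integral_add) (simp add: algebra_simps)
  qed
  ultimately show ?thesis by simp
qed

section \<open>Smooth functions and test functions\<close>

text \<open>Smoothness is reduced to finding a class of differentiable functions closed under
  \<open>deriv\<close>, so no formula for higher derivatives is required.\<close>

lemma smooth_coinduct:
  assumes "P f" and step: "\<And>g. P g \<Longrightarrow> (\<forall>x. g differentiable (at x)) \<and> P (deriv g)"
  shows "smooth f"
proof -
  have "P ((deriv ^^ k) f)" for k
    by (induction k) (simp_all add: assms)
  then show ?thesis using step by (auto simp: smooth_def)
qed

lemma smooth_deriv: "smooth f \<Longrightarrow> smooth (deriv f)"
  unfolding smooth_def by (metis funpow_Suc_right o_apply)

lemma smooth_has_deriv: "smooth f \<Longrightarrow> (f has_real_derivative deriv f x) (at x)"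
  unfolding smooth_def
  by (metis DERIV_deriv_iff_real_differentiable funpow_0)

lemma smooth_continuous_on: "smooth f \<Longrightarrow> continuous_on A f"
  by (meson DERIV_isCont continuous_at_imp_continuous_on smooth_has_deriv)

lemma smooth_borel_measurable: "smooth f \<Longrightarrow> f \<in> borel_measurable borel"
  by (intro borel_measurable_continuous_onI smooth_continuous_on)

text \<open>The invariant for smoothness of products: the product rule creates sums of products, so
  the class is closed under both operations.\<close>

inductive smooth_ring :: "(real \<Rightarrow> real) \<Rightarrow> bool" where
  base: "smooth f \<Longrightarrow> smooth_ring f"
| mult: "smooth_ring f \<Longrightarrow> smooth_ring g \<Longrightarrow> smooth_ring (\<lambda>x. f x * g x)"
| add: "smooth_ring f \<Longrightarrow> smooth_ring g \<Longrightarrow> smooth_ring (\<lambda>x. f x + g x)"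

lemma smooth_ring_has_deriv:
  "smooth_ring h \<Longrightarrow> \<exists>h'. smooth_ring h' \<and> (\<forall>x. (h has_real_derivative h' x) (at x))"
proof (induction rule: smooth_ring.induct)
  case (base f)
  then show ?case by (metis smooth_ring.base smooth_deriv smooth_has_deriv)
next
  case (mult f g)
  then obtain f' g' where *: "smooth_ring f'" "\<And>x. (f has_real_derivative f' x) (at x)"
    "smooth_ring g'" "\<And>x. (g has_real_derivative g' x) (at x)" by blast
  show ?case
    by (rule exI[of _ "\<lambda>x. f x * g' x + f' x * g x"])
       (auto intro!: smooth_ring.intros(2,3) * mult.hyps derivative_eq_intros simp: mult.commute)
next
  case (add f g)
  then obtain f' g' where *: "smooth_ring f'" "\<And>x. (f has_real_derivative f' x) (at x)"
    "smooth_ring g'" "\<And>x. (g has_real_derivative g' x) (at x)" by blast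
  show ?case
    by (rule exI[of _ "\<lambda>x. f' x + g' x"])
       (auto intro!: smooth_ring.intros(3) * derivative_eq_intros)
qed

lemma smooth_mult:
  assumes "smooth f" "smooth g"
  shows "smooth (\<lambda>x. f x * g x)"
proof (rule smooth_coinduct[of smooth_ring])
  show "smooth_ring (\<lambda>x. f x * g x)" using assms by (intro smooth_ring.intros)
  fix h assume "smooth_ring h"
  then obtain h' where h': "smooth_ring h'" "\<And>x. (h has_real_derivative h' x) (at x)"
    using smooth_ring_has_deriv by blast
  moreover from h'(2) have "deriv h = h'" by (intro ext DERIV_imp_deriv)
  ultimately show "(\<forall>x. h differentiable at x) \<and> smooth_ring (deriv h)"
    by (auto simp: real_differentiable_def)
qed

lemma smooth_scale_affine:
  assumes "smooth f"
  shows "smooth (\<lambda>x. c * f (a * x + b))"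
\<comment> \<open>Both \<open>c\<close> and \<open>f\<close> vary in the invariant, because
  differentiation replaces them by \<open>c * a\<close> and \<open>deriv f\<close>.\<close>
proof (rule smooth_coinduct[of "\<lambda>g. \<exists>c f. smooth f \<and> g = (\<lambda>x. c * f (a * x + b))"])
  fix g assume "\<exists>c f. smooth f \<and> g = (\<lambda>x. c * f (a * x + b))"
  then obtain c f where f: "smooth f" and g: "g = (\<lambda>x. c * f (a * x + b))" by blast
  have D: "(g has_real_derivative (c * a) * deriv f (a * x + b)) (at x)" for x
    unfolding g by (auto intro!: derivative_eq_intros DERIV_chain2[OF smooth_has_deriv[OF f]])
  then have "deriv g = (\<lambda>x. (c * a) * deriv f (a * x + b))" by (intro ext DERIV_imp_deriv)
  with D smooth_deriv[OF f] show "(\<forall>x. g differentiable at x) \<and> (\<exists>c f. smooth f \<and> deriv g = (\<lambda>x. c * f (a * x + b)))"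
    by (auto simp: real_differentiable_def)
qed (use assms in blast)

lemma deriv_poly: "deriv (poly p) = poly (pderiv p)" for p :: "real poly"
  by (intro ext DERIV_imp_deriv poly_DERIV)

lemma smooth_poly: "smooth (poly p)" for p :: "real poly"
proof (rule smooth_coinduct[of "\<lambda>g. \<exists>p. g = poly p"])
  fix g :: "real \<Rightarrow> real" assume "\<exists>p. g = poly p"
  then obtain p where "g = poly p" by blast
  then show "(\<forall>x. g differentiable at x) \<and> (\<exists>p. deriv g = poly p)"
    using deriv_poly poly_DERIV real_differentiable_def by metis
qed blast

section \<open>A smooth function of compact support\<close>

lemma poly_exp_minus_tendsto_0: "((\<lambda>t. poly p t * exp (- t)) \<longlongrightarrow> 0) at_top" for p :: "real poly"
proof -
  have "((\<lambda>t. \<Sum>i\<le>degree p. coeff p i * (t ^ i / exp t)) \<longlongrightarrow> (\<Sum>i\<le>degree p. coeff p i * 0)) at_top"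
    by (intro tendsto_intros tendsto_power_div_exp_0)
  then show ?thesis
    by (simp add: poly_altdef sum_distrib_right exp_minus divide_inverse mult.assoc)
qed

text \<open>The classical function that is flat at 0. The polynomial parameter makes the family
  closed under differentiation.\<close>

definition flat_exp :: "real poly \<Rightarrow> real \<Rightarrow> real" where
  "flat_exp p x = (if x > 0 then poly p (1 / x) * exp (- (1 / x)) else 0)"

text \<open>For x > 0 the chain rule with t = 1/x gives the factor t^2 (p(t) - p'(t)), which
  explains the polynomial \<open>[:0, 0, 1:] * (p - pderiv p)\<close>. At 0 the exponential beats
  every polynomial in 1/x.\<close>

lemma flat_exp_has_deriv:
  "(flat_exp p has_real_derivative flat_exp ([:0, 0, 1:] * (p - pderiv p)) x) (at x)"
proof -
  consider "x > 0" | "x < 0" | "x = 0" by linarith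
  then show ?thesis
  proof cases
    case 1
    have "((\<lambda>x. poly p (1 / x) * exp (- (1 / x))) has_real_derivative flat_exp ([:0, 0, 1:] * (p - pderiv p)) x) (at x)"
      using 1 by (auto intro!: derivative_eq_intros DERIV_chain2[OF poly_DERIV]
          simp: flat_exp_def field_simps power2_eq_square)
    then show ?thesis
      by (rule has_field_derivative_transform_within_open[of _ _ _ "{0<..}"])
         (use 1 in \<open>auto simp: flat_exp_def\<close>)
  next
    case 2
    have "((\<lambda>x. 0) has_real_derivative flat_exp ([:0, 0, 1:] * (p - pderiv p)) x) (at x)"
      using 2 by (simp add: flat_exp_def)
    then show ?thesis
      by (rule has_field_derivative_transform_within_open[of _ _ _ "{..<0}"])
         (use 2 in \<open>auto simp: flat_exp_def\<close>)
  next
    case 3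
    \<comment> \<open>Dividing by h multiplies the polynomial in 1/h by its variable, hence
      \<open>pCons 0 p\<close>.\<close>
    have "((\<lambda>h. poly (pCons 0 p) (1 / h) * exp (- (1 / h))) \<longlongrightarrow> 0) (at_right 0)"
      using filterlim_compose[OF poly_exp_minus_tendsto_0[of "pCons 0 p"] filterlim_inverse_at_top_right]
      by (simp add: inverse_eq_divide)
    then have "((\<lambda>h. flat_exp p h / h) \<longlongrightarrow> 0) (at_right 0)"
      by (rule Lim_transform_eventually)
         (auto simp: flat_exp_def intro!: eventually_at_rightI[of 0 1])
    moreover have "((\<lambda>h. flat_exp p h / h) \<longlongrightarrow> 0) (at_left 0)"
      by (rule tendsto_eventually) (auto simp: flat_exp_def intro!: eventually_at_leftI[of "-1"])
    ultimately have "((\<lambda>h. flat_exp p h / h) \<longlongrightarrow> 0) (at 0)"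
      by (simp add: filterlim_split_at)
    then show ?thesis
      using 3 by (simp add: DERIV_def flat_exp_def)
  qed
qed

lemma smooth_flat_exp: "smooth (flat_exp p)"
proof (rule smooth_coinduct[of "\<lambda>g. \<exists>p. g = flat_exp p"])
  fix g :: "real \<Rightarrow> real" assume "\<exists>p. g = flat_exp p"
  then obtain p where g: "g = flat_exp p" by blast
  have "deriv g = flat_exp ([:0, 0, 1:] * (p - pderiv p))"
    unfolding g by (intro ext DERIV_imp_deriv flat_exp_has_deriv)
  then show "(\<forall>x. g differentiable at x) \<and> (\<exists>p. deriv g = flat_exp p)"
    using g flat_exp_has_deriv by (auto simp: real_differentiable_def)
qed blast

lemma ex_test_fun_eq_1_at_0: "\<exists>\<eta>. test_fun \<eta> \<and> \<eta> 0 = 1"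
proof -
  \<comment> \<open>Two flat functions facing each other cut the support down to [-1, 1]. Each
    equals exp(-1) at 0, so \<open>exp 2\<close> normalises the value there.\<close>
  define \<eta> where "\<eta> x = (exp 2 * flat_exp 1 (1 * x + 1)) * (1 * flat_exp 1 (-1 * x + 1))" for x
  have "smooth \<eta>"
    unfolding \<eta>_def by (intro smooth_mult smooth_scale_affine smooth_flat_exp)
  moreover have "{x. \<eta> x \<noteq> 0} \<subseteq> {-1..1}"
    by (auto simp: \<eta>_def flat_exp_def split: if_splits)
  then have "bounded {x. \<eta> x \<noteq> 0}"
    using bounded_subset bounded_closed_interval by blast
  moreover have "\<eta> 0 = 1"
    by (simp add: \<eta>_def flat_exp_def flip: exp_add)
  ultimately show ?thesis by (auto simp: test_fun_def)
qed

section \<open>Derivatives, bounds and cutoffs of test functions\<close>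

lemma test_fun_deriv:
  assumes "test_fun \<phi>"
  shows "test_fun (deriv \<phi>)"
proof -
  have "deriv \<phi> x = 0" if "x \<notin> closure {x. \<phi> x \<noteq> 0}" for x
  proof (rule DERIV_imp_deriv, rule has_field_derivative_transform_within_open)
    show "((\<lambda>_. 0) has_real_derivative 0) (at x)" by simp
    show "x \<in> - closure {x. \<phi> x \<noteq> 0}" using that by simp
    show "0 = \<phi> y" if "y \<in> - closure {x. \<phi> x \<noteq> 0}" for y
      using that closure_subset by force
  qed (simp add: open_Compl)
  then have "{x. deriv \<phi> x \<noteq> 0} \<subseteq> closure {x. \<phi> x \<noteq> 0}" by blast
  then have "bounded {x. deriv \<phi> x \<noteq> 0}"
    using assms by (auto simp: test_fun_def intro: bounded_subset[OF bounded_closure])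
  then show ?thesis using assms by (simp add: test_fun_def smooth_deriv)
qed

lemma compact_support_bounded:
  fixes \<phi> :: "real \<Rightarrow> real"
  assumes "continuous_on UNIV \<phi>" and "compact (closure {x. \<phi> x \<noteq> 0})"
  obtains B where "\<And>x. \<bar>\<phi> x\<bar> \<le> B"
proof -
  have "compact (\<phi> ` closure {x. \<phi> x \<noteq> 0})"
    using assms by (intro compact_continuous_image) (auto intro: continuous_on_subset)
  then obtain B where B: "\<And>x. x \<in> closure {x. \<phi> x \<noteq> 0} \<Longrightarrow> \<bar>\<phi> x\<bar> \<le> B"
    unfolding bounded_iff using compact_imp_bounded bounded_iff by (metis (no_types, lifting) imageI real_norm_def)
  have "\<bar>\<phi> x\<bar> \<le> max B 0" for x
    using B[of x] closure_subset[of "{x. \<phi> x \<noteq> 0}"] by (cases "\<phi> x = 0") auto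
  then show ?thesis by (rule that)
qed

lemma test_fun_bounded:
  assumes "test_fun \<phi>"
  obtains B where "\<And>x. \<bar>\<phi> x\<bar> \<le> B"
  using assms compact_support_bounded[of \<phi>] by (auto simp: test_fun_def smooth_continuous_on)

lemma test_fun_cutoff:
  assumes "smooth f" "test_fun \<eta>" "a \<noteq> 0"
  shows "test_fun (\<lambda>x. f x * \<eta> (a * x))"
proof -
  have "smooth (\<lambda>x. f x * (1 * \<eta> (a * x + 0)))"
    using assms by (intro smooth_mult smooth_scale_affine) (auto simp: test_fun_def)
  moreover have "{x. f x * \<eta> (a * x) \<noteq> 0} \<subseteq> (\<lambda>y. (1 / a) *\<^sub>R y) ` {y. \<eta> y \<noteq> 0}"
  proof
    fix x assume "x \<in> {x. f x * \<eta> (a * x) \<noteq> 0}"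
    then show "x \<in> (\<lambda>y. (1 / a) *\<^sub>R y) ` {y. \<eta> y \<noteq> 0}"
      using \<open>a \<noteq> 0\<close> by (intro image_eqI[of _ _ "a * x"]) auto
  qed
  moreover have "bounded ((\<lambda>y. (1 / a) *\<^sub>R y) ` {y. \<eta> y \<noteq> 0})"
    using assms by (intro bounded_scaling) (simp add: test_fun_def)
  ultimately have "smooth (\<lambda>x. f x * \<eta> (a * x))" "bounded {x. f x * \<eta> (a * x) \<noteq> 0}"
    by (simp, metis bounded_subset)
  then show ?thesis by (simp add: test_fun_def)
qed

section \<open>Polynomial growth and integration by parts\<close>

text \<open>The base is at least 1, so bounds with different exponents can be combined. For
  functions in this class the integrals against the weight converge and the boundary terms
  vanish.\<close>

definition poly_growth :: "(real \<Rightarrow> real) \<Rightarrow> bool" where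
  "poly_growth h \<longleftrightarrow> (\<exists>C m. \<forall>x. \<bar>h x\<bar> \<le> C * (1 + x\<^sup>2) ^ m)"

lemma poly_growthI: "(\<And>x. \<bar>h x\<bar> \<le> C * (1 + x\<^sup>2) ^ m) \<Longrightarrow> poly_growth h"
  unfolding poly_growth_def by blast

lemma poly_growth_bounded: "(\<And>x. \<bar>h x\<bar> \<le> C) \<Longrightarrow> poly_growth h"
  by (rule poly_growthI[of _ C 0]) simp

lemma poly_growth_mono:
  assumes "poly_growth g" and "\<And>x. \<bar>h x\<bar> \<le> \<bar>g x\<bar>"
  shows "poly_growth h"
  using assms unfolding poly_growth_def by (meson order_trans)

lemma poly_growth_const: "poly_growth (\<lambda>_. c)"
  by (rule poly_growth_bounded[of _ "\<bar>c\<bar>"]) simp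

lemma poly_growth_ident: "poly_growth (\<lambda>x. x)"
proof (rule poly_growthI)
  fix x :: real
  show "\<bar>x\<bar> \<le> 1 * (1 + x\<^sup>2) ^ 1"
    using sum_squares_bound[of "\<bar>x\<bar>" 1] by simp
qed

lemma poly_growth_add:
  assumes "poly_growth f" "poly_growth g"
  shows "poly_growth (\<lambda>x. f x + g x)"
proof -
  from assms obtain C m D n where f: "\<And>x. \<bar>f x\<bar> \<le> C * (1 + x\<^sup>2) ^ m"
    and g: "\<And>x. \<bar>g x\<bar> \<le> D * (1 + x\<^sup>2) ^ n" unfolding poly_growth_def by blast
  have "0 \<le> C" "0 \<le> D" using f[of 0] g[of 0] by auto
  show ?thesis
  proof (rule poly_growthI)
    fix x
    have "\<bar>f x + g x\<bar> \<le> C * (1 + x\<^sup>2) ^ m + D * (1 + x\<^sup>2) ^ n"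
      using f[of x] g[of x] by linarith
    also have "\<dots> \<le> C * (1 + x\<^sup>2) ^ (m + n) + D * (1 + x\<^sup>2) ^ (m + n)"
      using \<open>0 \<le> C\<close> \<open>0 \<le> D\<close> by (intro add_mono mult_left_mono power_increasing) auto
    finally show "\<bar>f x + g x\<bar> \<le> (C + D) * (1 + x\<^sup>2) ^ (m + n)" by (simp add: distrib_right)
  qed
qed

lemma poly_growth_mult:
  assumes "poly_growth f" "poly_growth g"
  shows "poly_growth (\<lambda>x. f x * g x)"
proof -
  from assms obtain C m D n where f: "\<And>x. \<bar>f x\<bar> \<le> C * (1 + x\<^sup>2) ^ m"
    and g: "\<And>x. \<bar>g x\<bar> \<le> D * (1 + x\<^sup>2) ^ n" unfolding poly_growth_def by blast
  have "0 \<le> C" using f[of 0] by auto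
  show ?thesis
  proof (rule poly_growthI)
    fix x
    have "\<bar>f x * g x\<bar> \<le> (C * (1 + x\<^sup>2) ^ m) * (D * (1 + x\<^sup>2) ^ n)"
      unfolding abs_mult using f[of x] g[of x] by (intro mult_mono) auto
    then show "\<bar>f x * g x\<bar> \<le> (C * D) * (1 + x\<^sup>2) ^ (m + n)"
      by (simp add: power_add mult_ac)
  qed
qed

lemma poly_growth_minus: "poly_growth f \<Longrightarrow> poly_growth (\<lambda>x. - f x)"
  by (rule poly_growth_mono) auto

lemma poly_growth_diff: "poly_growth f \<Longrightarrow> poly_growth g \<Longrightarrow> poly_growth (\<lambda>x. f x - g x)"
  using poly_growth_add[of f "\<lambda>x. - g x"] poly_growth_minus[of g] by simp

lemma poly_growth_power: "poly_growth f \<Longrightarrow> poly_growth (\<lambda>x. f x ^ n)"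
  by (induction n) (auto intro: poly_growth_const poly_growth_mult)

lemma poly_growth_poly: "poly_growth (poly p)"
proof (induction p)
  case 0
  then show ?case by (simp add: poly_growth_const)
next
  case (pCons a p)
  then show ?case by (simp add: poly_growth_const poly_growth_add poly_growth_mult poly_growth_ident)
qed

lemmas poly_growth_intros = poly_growth_const poly_growth_ident poly_growth_add poly_growth_mult
  poly_growth_minus poly_growth_diff poly_growth_power poly_growth_poly

text \<open>From (y/k)^k <= (1 + y/k)^k <= exp y. The constant is explicit so that the decay of the
  weight can be bounded uniformly in x.\<close>

lemma power_le_exp: "y ^ k \<le> real k ^ k * exp y" if "0 \<le> y" for y :: real
proof (cases "k = 0")
  case False
  have "(y / real k) ^ k \<le> (1 + y / real k) ^ k"
    using that by (intro power_mono) auto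
  also have "\<dots> \<le> exp y"
    using that False by (intro exp_ge_one_plus_x_over_n_power_n) auto
  finally show ?thesis using False by (simp add: power_divide field_simps)
qed (use that in simp)

section \<open>Uniformly convex potentials and the decay of their weight\<close>

text \<open>\<open>V1\<close> and \<open>V2\<close> stand for V' and V'', and \<open>r\<close> is a
  positive lower bound of V'', instantiated at the end by its infimum.\<close>

locale uniformly_convex =
  fixes V V1 V2 :: "real \<Rightarrow> real" and r :: real
  assumes r_pos: "0 < r"
    and dV: "\<And>x. (V has_real_derivative V1 x) (at x)"
    and dV1: "\<And>x. (V1 has_real_derivative V2 x) (at x)"
    and V2_ge: "\<And>x. r \<le> V2 x"
begin

abbreviation E :: "(real \<Rightarrow> real) \<Rightarrow> real" where
  "E h \<equiv> integral\<^sup>L (mu V) h"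

lemma continuous_V: "continuous_on A V"
  by (meson DERIV_isCont continuous_at_imp_continuous_on dV)

lemma continuous_V1: "continuous_on A V1"
  by (meson DERIV_isCont continuous_at_imp_continuous_on dV1)

lemma V_measurable [measurable]: "V \<in> borel_measurable borel"
  by (intro borel_measurable_continuous_onI continuous_V)

lemma V1_measurable [measurable]: "V1 \<in> borel_measurable borel"
  by (intro borel_measurable_continuous_onI continuous_V1)

lemma V1_increment:
  assumes "x \<le> y"
  shows "r * (y - x) \<le> V1 y - V1 x"
proof -
  have "V1 x - r * x \<le> V1 y - r * y"
  proof (rule DERIV_nonneg_imp_nondecreasing[OF assms])
    fix z
    show "\<exists>d. ((\<lambda>x. V1 x - r * x) has_real_derivative d) (at z) \<and> 0 \<le> d"
      by (rule exI[of _ "V2 z - r"]) (auto intro!: derivative_eq_intros dV1 simp: V2_ge)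
  qed
  then show ?thesis by (simp add: algebra_simps)
qed

lemma V1_mono: "x \<le> y \<Longrightarrow> V1 x \<le> V1 y"
  using V1_increment[of x y] r_pos by (smt (verit) mult_nonneg_nonneg)

lemma V_ge_quadratic: "V 0 + V1 0 * x + r / 2 * x\<^sup>2 \<le> V x"
proof -
  define g where "g y = V y - V1 0 * y - r / 2 * y\<^sup>2" for y
  have dg: "(g has_real_derivative V1 y - V1 0 - r * y) (at y)" for y
    unfolding g_def by (auto intro!: derivative_eq_intros dV)
  have "g 0 \<le> g x"
  proof (cases "0 \<le> x")
    case True
    then show ?thesis
    proof (rule DERIV_nonneg_imp_nondecreasing)
      fix y :: real assume "0 \<le> y"
      then show "\<exists>d. (g has_real_derivative d) (at y) \<and> 0 \<le> d"
        using dg[of y] V1_increment[of 0 y] by (intro exI[of _ "V1 y - V1 0 - r * y"]) simp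
    qed
  next
    case False
    then have "x \<le> 0" by simp
    then show ?thesis
    proof (rule DERIV_nonpos_imp_nonincreasing)
      fix y :: real assume "y \<le> 0"
      then show "\<exists>d. (g has_real_derivative d) (at y) \<and> d \<le> 0"
        using dg[of y] V1_increment[of y 0] by (intro exI[of _ "V1 y - V1 0 - r * y"]) simp
    qed
  qed
  then show ?thesis by (simp add: g_def)
qed

lemma V_ge: "\<exists>c. \<forall>x. c + r / 4 * (1 + x\<^sup>2) \<le> V x"
proof (intro exI allI)
  fix x
  \<comment> \<open>Completing the square: half of the quadratic term r/2 x^2 absorbs the linear
    term, the other half remains.\<close>
  have "0 \<le> r / 4 * (x + 2 * V1 0 / r)\<^sup>2" using r_pos by simp
  also have "\<dots> = r / 4 * x\<^sup>2 + V1 0 * x + (V1 0)\<^sup>2 / r"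
    using r_pos by (simp add: power2_eq_square field_simps)
  finally show "(V 0 - r / 4 - (V1 0)\<^sup>2 / r) + r / 4 * (1 + x\<^sup>2) \<le> V x"
    using V_ge_quadratic[of x] by (simp add: algebra_simps)
qed

text \<open>With t = 1 + x^2 the weight is at most a constant times exp(-r t/4), which dominates
  every power of t. The majorant 1/t is both integrable and vanishing at infinity, as needed for
  integrals and boundary terms.\<close>

lemma poly_growth_times_weight:
  assumes "poly_growth h"
  shows "\<exists>K. \<forall>x. \<bar>h x * exp (- V x)\<bar> \<le> K * inverse (1 + x\<^sup>2)"
proof -
  obtain C m where h: "\<And>x. \<bar>h x\<bar> \<le> C * (1 + x\<^sup>2) ^ m"
    using assms unfolding poly_growth_def by blast
  have "0 \<le> C" using h[of 0] by auto
  obtain c where c: "\<And>x. c + r / 4 * (1 + x\<^sup>2) \<le> V x" using V_ge by blast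
  \<comment> \<open>One power more than the growth of \<open>h\<close>, to leave the factor
    1/t.\<close>
  define k where "k = Suc m"
  define K where "K = C * (4 / r) ^ k * real k ^ k * exp (- c)"
  have "\<bar>h x * exp (- V x)\<bar> \<le> K * inverse (1 + x\<^sup>2)" for x
  proof -
    define t where "t = 1 + x\<^sup>2"
    have "t > 0" by (simp add: t_def add_pos_nonneg)
    have "(r / 4 * t) ^ k \<le> real k ^ k * exp (r / 4 * t)"
      using \<open>t > 0\<close> r_pos by (intro power_le_exp) simp
    then have "t ^ k \<le> (4 / r) ^ k * (real k ^ k * exp (r / 4 * t))"
      using r_pos by (simp add: power_mult_distrib power_divide field_simps)
    then have tk: "t ^ k * exp (- (r / 4 * t)) \<le> (4 / r) ^ k * real k ^ k"
      by (simp add: exp_minus field_simps)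
    have "\<bar>h x * exp (- V x)\<bar> \<le> C * t ^ m * exp (- (c + r / 4 * t))"
      unfolding abs_mult using h[of x] c[of x] \<open>0 \<le> C\<close> \<open>t > 0\<close>
      by (intro mult_mono) (auto simp: t_def)
    also have "\<dots> = C * exp (- c) * (t ^ k * exp (- (r / 4 * t))) * inverse t"
      using \<open>t > 0\<close> mult_exp_exp[of "- c" "- (r / 4 * t)"] by (simp add: k_def mult_ac)
    also have "\<dots> \<le> C * exp (- c) * ((4 / r) ^ k * real k ^ k) * inverse t"
      using tk \<open>0 \<le> C\<close> \<open>t > 0\<close> by (intro mult_right_mono mult_left_mono) auto
    finally show ?thesis by (simp add: K_def t_def mult_ac)
  qed
  then show ?thesis by blast
qed

lemma integrable_weight:
  assumes "poly_growth h" and [measurable]: "h \<in> borel_measurable borel"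
  shows "integrable lborel (\<lambda>x. h x * exp (- V x))"
proof -
  obtain K where K: "\<And>x. \<bar>h x * exp (- V x)\<bar> \<le> K * inverse (1 + x\<^sup>2)"
    using poly_growth_times_weight[OF assms(1)] by blast
  show ?thesis
  proof (rule Bochner_Integration.integrable_bound)
    show "integrable lborel (\<lambda>x. K * inverse (1 + x\<^sup>2))"
      using integrable_inverse_1_plus_square_lborel by simp
    show "AE x in lborel. norm (h x * exp (- V x)) \<le> norm (K * inverse (1 + x\<^sup>2))"
      using K by (auto intro!: AE_I2 order_trans[OF _ abs_ge_self])
  qed simp
qed

lemma weight_tendsto_0:
  assumes "poly_growth h"
  shows "((\<lambda>x. h x * exp (- V x)) \<longlongrightarrow> 0) at_top" "((\<lambda>x. h x * exp (- V x)) \<longlongrightarrow> 0) at_bot"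
proof -
  obtain K where K: "\<And>x. \<bar>h x * exp (- V x)\<bar> \<le> K * inverse (1 + x\<^sup>2)"
    using poly_growth_times_weight[OF assms] by blast
  have "((\<lambda>x. K * inverse (1 + x\<^sup>2)) \<longlongrightarrow> 0) at_top" by real_asymp
  then show "((\<lambda>x. h x * exp (- V x)) \<longlongrightarrow> 0) at_top"
    by (rule Lim_null_comparison[rotated]) (use K in auto)
  have "((\<lambda>x. K * inverse (1 + x\<^sup>2)) \<longlongrightarrow> 0) at_bot" by real_asymp
  then show "((\<lambda>x. h x * exp (- V x)) \<longlongrightarrow> 0) at_bot"
    by (rule Lim_null_comparison[rotated]) (use K in auto)
qed

section \<open>The normalised measure and its integrals\<close>

definition Z :: real where "Z = (\<integral>x. exp (- V x) \<partial>lborel)"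

lemma Z_pos: "0 < Z"
proof -
  have "integrable lborel (\<lambda>x. exp (- V x))"
    using integrable_weight[of "\<lambda>_. 1"] poly_growth_const by simp
  then have "Z = 0 \<longleftrightarrow> (AE x in lborel. exp (- V x) = 0)"
    unfolding Z_def by (intro integral_nonneg_eq_0_iff_AE) auto
  then have "Z \<noteq> 0"
    using ae_filter_eq_bot_iff[of "lborel :: real measure"] by (simp add: trivial_limit_def)
  moreover have "0 \<le> Z" by (simp add: Z_def)
  ultimately show ?thesis by simp
qed

lemma mu_eq: "mu V = density lborel (\<lambda>x. ennreal (exp (- V x) / Z))"
  by (simp add: mu_def Z_def)

lemma sets_mu [simp, measurable_cong]: "sets (mu V) = sets borel"
  by (simp add: mu_def)

lemma space_mu [simp]: "space (mu V) = UNIV"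
  by (simp add: mu_def)

lemma integrable_mu_iff:
  assumes [measurable]: "h \<in> borel_measurable borel"
  shows "integrable (mu V) h \<longleftrightarrow> integrable lborel (\<lambda>x. h x * exp (- V x))"
proof -
  have "integrable (mu V) h \<longleftrightarrow> integrable lborel (\<lambda>x. (1 / Z) * (h x * exp (- V x)))"
    unfolding mu_eq using Z_pos by (subst integrable_density) (auto simp: mult_ac)
  then show ?thesis using Z_pos by (subst (asm) integrable_mult_left_iff) auto
qed

lemma integral_mu:
  assumes [measurable]: "h \<in> borel_measurable borel"
  shows "E h = (\<integral>x. h x * exp (- V x) \<partial>lborel) / Z"
proof -
  have "E h = (\<integral>x. (1 / Z) * (h x * exp (- V x)) \<partial>lborel)"
    unfolding mu_eq using Z_pos by (subst integral_density) (auto simp: mult_ac)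
  then show ?thesis by simp
qed

lemma measure_mu_UNIV [simp]: "measure (mu V) UNIV = 1"
  using integral_mu[of "\<lambda>_. 1"] Z_pos by (simp flip: Z_def)

lemma integrable_mu_poly_growth:
  "poly_growth h \<Longrightarrow> h \<in> borel_measurable borel \<Longrightarrow> integrable (mu V) h"
  by (simp add: integrable_mu_iff integrable_weight)

lemma integrable_mu_continuous:
  "poly_growth h \<Longrightarrow> continuous_on UNIV h \<Longrightarrow> integrable (mu V) h"
  by (simp add: integrable_mu_poly_growth borel_measurable_continuous_onI)

lemma integrable_mu_const [simp]: "integrable (mu V) (\<lambda>_. c :: real)"
  by (intro integrable_mu_continuous poly_growth_const continuous_on_const)

section \<open>Integration by parts against the weight\<close>

text \<open>The derivative of h exp(-V) is (h' - V' h) exp(-V), and its boundary values vanish. The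
  inequality form lets the continuous minorant \<open>k\<close> carry the integrability: terms with
  V'', whose growth is not controlled, are replaced by constant multiples before
  integrating.\<close>

lemma integration_by_parts_le:
  assumes dh: "\<And>x. (h has_real_derivative h' x) (at x)" and "poly_growth h"
    and k: "continuous_on UNIV k" "poly_growth k"
    and le: "\<And>x. k x \<le> h' x - V1 x * h x"
  shows "E k \<le> 0"
proof -
  have [measurable]: "k \<in> borel_measurable borel" using k by (simp add: borel_measurable_continuous_onI)
  have int: "integrable lborel (\<lambda>x. k x * exp (- V x))" using k by (intro integrable_weight) auto
  have cont: "continuous_on UNIV (\<lambda>x. k x * exp (- V x))" by (intro continuous_intros continuous_V k)
  obtain K where dK: "\<And>x. (K has_real_derivative k x * exp (- V x)) (at x)"
    and K_bot: "(K \<longlongrightarrow> 0) at_bot" and K_top: "(K \<longlongrightarrow> (\<integral>x. k x * exp (- V x) \<partial>lborel)) at_top"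
    using antiderivative_lborel[OF int cont] by blast
  \<comment> \<open>\<open>G\<close> is nondecreasing, tends to 0 at minus infinity and to minus the
    integral of k exp(-V) at plus infinity; comparing both ends with \<open>G 0\<close> gives the
    sign.\<close>
  define G where "G x = h x * exp (- V x) - K x" for x
  have dG: "(G has_real_derivative (h' x - V1 x * h x - k x) * exp (- V x)) (at x)" for x
    unfolding G_def by (auto intro!: derivative_eq_intros dh dV dK simp: algebra_simps)
  have mono: "G x \<le> G y" if "x \<le> y" for x y
    using that by (rule DERIV_nonneg_imp_nondecreasing) (use dG le in fastforce)
  have "(G \<longlongrightarrow> 0 - 0) at_bot"
    unfolding G_def by (intro tendsto_diff weight_tendsto_0 K_bot assms)
  then have "0 \<le> G 0"
    by (intro tendsto_upperbound[of G 0 at_bot])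
       (auto intro!: eventually_mono[OF eventually_le_at_bot[of 0]] mono)
  have "(G \<longlongrightarrow> 0 - (\<integral>x. k x * exp (- V x) \<partial>lborel)) at_top"
    unfolding G_def by (intro tendsto_diff weight_tendsto_0 K_top assms)
  then have "G 0 \<le> 0 - (\<integral>x. k x * exp (- V x) \<partial>lborel)"
    by (rule tendsto_lowerbound)
       (auto intro!: eventually_mono[OF eventually_ge_at_top[of 0]] mono)
  with \<open>0 \<le> G 0\<close> have "(\<integral>x. k x * exp (- V x) \<partial>lborel) \<le> 0" by simp
  then show ?thesis
    using Z_pos by (simp add: integral_mu divide_nonpos_pos)
qed

lemma integration_by_parts:
  assumes dh: "\<And>x. (h has_real_derivative h' x) (at x)" and "poly_growth h"
    and k: "continuous_on UNIV k" "poly_growth k"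
    and eq: "\<And>x. h' x - V1 x * h x = k x"
  shows "E k = 0"
proof (rule antisym)
  show "E k \<le> 0" by (rule integration_by_parts_le[of h h']) (auto simp: assms)
  have "E (\<lambda>x. - k x) \<le> 0"
  proof (rule integration_by_parts_le)
    show "((\<lambda>x. - h x) has_real_derivative - h' x) (at x)" for x by (intro DERIV_minus dh)
    show "- k x \<le> - h' x - V1 x * - h x" for x using eq[of x] by simp
  qed (intro continuous_on_minus poly_growth_minus assms)+
  then show "0 \<le> E k" by simp
qed

end

section \<open>The lower bound for the energy\<close>

context uniformly_convex
begin

text \<open>The equation \<open>V' u - u' = f\<close> says that \<open>u\<close> is mapped to \<open>f\<close> by the adjoint of \<open>d/dx\<close>.\<close>

lemma adjoint_derivative_solvable:
  assumes cont: "continuous_on UNIV f" and B: "\<And>x. \<bar>f x\<bar> \<le> B" and mean: "E f = 0"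
  obtains u where "\<And>x. (u has_real_derivative V1 x * u x - f x) (at x)"
    and "\<And>x. \<bar>V1 x * u x\<bar> \<le> B" and "\<exists>C. \<forall>x. \<bar>u x\<bar> \<le> C"
proof -
  have [measurable]: "f \<in> borel_measurable borel" using cont by (simp add: borel_measurable_continuous_onI)
  have pg: "poly_growth f" using B by (rule poly_growth_bounded)
  have int: "integrable lborel (\<lambda>x. f x * exp (- V x))" using pg by (intro integrable_weight) auto
  have "continuous_on UNIV (\<lambda>x. f x * exp (- V x))" by (intro continuous_intros continuous_V cont)
  moreover have "(\<integral>x. f x * exp (- V x) \<partial>lborel) = 0" using mean Z_pos by (simp add: integral_mu)
  ultimately obtain K where dK: "\<And>x. (K has_real_derivative f x * exp (- V x)) (at x)"
    and K_bot: "(K \<longlongrightarrow> 0) at_bot" and K_top: "(K \<longlongrightarrow> 0) at_top"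
    using antiderivative_lborel[OF int] by metis
  \<comment> \<open>Since \<open>K\<close> vanishes at plus infinity, u(x) is exp(V(x)) times the
    integral of f exp(-V) over [x, infinity). Mean zero makes it equally minus the integral from the
    left, so either end can be used for estimates.\<close>
  define u where "u x = - K x * exp (V x)" for x
  have du: "(u has_real_derivative V1 x * u x - f x) (at x)" for x
    unfolding u_def by (auto intro!: derivative_eq_intros dK dV simp: algebra_simps simp flip: exp_add)
  have w_lim: "((\<lambda>y. B * exp (- V y)) \<longlongrightarrow> 0) at_top" "((\<lambda>y. B * exp (- V y)) \<longlongrightarrow> 0) at_bot"
    using weight_tendsto_0[of "\<lambda>_. B"] poly_growth_const by auto
  have "0 \<le> B" using B[of 0] by linarith
  \<comment> \<open>The two signs of \<open>\<sigma>\<close> give the bound for the absolute value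
    of \<open>K\<close>. The comparison starts from the end of the line towards which V' keeps its
    sign and grows in absolute value.\<close>
  have bound: "\<bar>V1 x\<bar> * (\<sigma> * K x) \<le> B * exp (- V x)" if \<sigma>: "\<bar>\<sigma>\<bar> = 1" for x \<sigma>
  proof (cases "0 \<le> V1 x")
    case True
    \<comment> \<open>The factor \<open>V1 x\<close> is frozen. On [x, infinity) one has V' >=
      \<open>V1 x\<close> >= 0 and |f| <= B, so \<open>\<Phi>\<close> decreases to its limit 0 and
      is nonnegative at x.\<close>
    define \<Phi> where "\<Phi> y = B * exp (- V y) - V1 x * (\<sigma> * K y)" for y
    have d\<Phi>: "(\<Phi> has_real_derivative - (B * V1 y + V1 x * (\<sigma> * f y)) * exp (- V y)) (at y)" for y
      unfolding \<Phi>_def by (auto intro!: derivative_eq_intros dK dV simp: algebra_simps)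
    have "\<Phi> y \<le> \<Phi> x" if "x \<le> y" for y
      using that
    proof (rule DERIV_nonpos_imp_nonincreasing)
      fix z assume "x \<le> z"
      have "\<bar>V1 x * (\<sigma> * f z)\<bar> \<le> V1 z * B"
        unfolding abs_mult \<sigma> using True V1_mono[OF \<open>x \<le> z\<close>] B[of z] by (intro mult_mono) auto
      then have "0 \<le> B * V1 z + V1 x * (\<sigma> * f z)" by (simp add: mult.commute)
      then have "- (B * V1 z + V1 x * (\<sigma> * f z)) * exp (- V z) \<le> 0"
        by (simp only: mult_minus_left neg_le_0_iff_le) simp
      with d\<Phi>[of z] show "\<exists>d. (\<Phi> has_real_derivative d) (at z) \<and> d \<le> 0" by blast
    qed
    moreover have "(\<Phi> \<longlongrightarrow> 0 - V1 x * (\<sigma> * 0)) at_top"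
      unfolding \<Phi>_def by (intro tendsto_intros w_lim K_top)
    ultimately have "0 \<le> \<Phi> x"
      by (intro tendsto_upperbound[of \<Phi> 0 at_top])
         (auto intro!: eventually_mono[OF eventually_ge_at_top[of x]])
    then show ?thesis using True by (simp add: \<Phi>_def)
  next
    case False
    \<comment> \<open>The mirror image: on (-infinity, x] one has V' <= \<open>V1 x\<close> < 0, and
      \<open>\<Phi>\<close> increases from its limit 0 at minus infinity.\<close>
    define \<Phi> where "\<Phi> y = B * exp (- V y) + V1 x * (\<sigma> * K y)" for y
    have d\<Phi>: "(\<Phi> has_real_derivative (V1 x * (\<sigma> * f y) - B * V1 y) * exp (- V y)) (at y)" for y
      unfolding \<Phi>_def by (auto intro!: derivative_eq_intros dK dV simp: algebra_simps)
    have "\<Phi> y \<le> \<Phi> x" if "y \<le> x" for y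
      using that
    proof (rule DERIV_nonneg_imp_nondecreasing)
      fix z assume "z \<le> x"
      have "\<bar>V1 x * (\<sigma> * f z)\<bar> \<le> (- V1 z) * B"
        unfolding abs_mult \<sigma> using False V1_mono[OF \<open>z \<le> x\<close>] B[of z] by (intro mult_mono) auto
      then have "0 \<le> V1 x * (\<sigma> * f z) - B * V1 z" by (simp add: mult.commute)
      then have "0 \<le> (V1 x * (\<sigma> * f z) - B * V1 z) * exp (- V z)" by simp
      with d\<Phi>[of z] show "\<exists>d. (\<Phi> has_real_derivative d) (at z) \<and> 0 \<le> d" by blast
    qed
    moreover have "(\<Phi> \<longlongrightarrow> 0 + V1 x * (\<sigma> * 0)) at_bot"
      unfolding \<Phi>_def by (intro tendsto_intros w_lim K_bot)
    ultimately have "0 \<le> \<Phi> x"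
      by (intro tendsto_upperbound[of \<Phi> 0 at_bot])
         (auto intro!: eventually_mono[OF eventually_le_at_bot[of x]])
    then show ?thesis using False by (simp add: \<Phi>_def)
  qed
  have Vu: "\<bar>V1 x * u x\<bar> \<le> B" for x
  proof -
    have "\<bar>V1 x\<bar> * \<bar>K x\<bar> \<le> B * exp (- V x)"
      using bound[of 1 x] bound[of "-1" x] by (cases "0 \<le> K x") auto
    then have "\<bar>V1 x\<bar> * \<bar>K x\<bar> * exp (V x) \<le> B * exp (- V x) * exp (V x)" by simp
    then show ?thesis by (simp add: u_def abs_mult mult.assoc flip: exp_add)
  qed
  \<comment> \<open>Outside [-R, R] uniform convexity forces |V'| >= 1, so the bound on V' u bounds
    u; inside, compactness does.\<close>
  define R where "R = (1 + \<bar>V1 0\<bar>) / r"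
  have V1_big: "1 \<le> \<bar>V1 x\<bar>" if "x \<notin> {-R..R}" for x
  proof -
    have "1 + \<bar>V1 0\<bar> \<le> r * \<bar>x\<bar>"
    proof -
      have "R < \<bar>x\<bar>" using that by auto
      then show ?thesis using r_pos by (simp add: R_def field_simps)
    qed
    moreover have "r * \<bar>x\<bar> \<le> \<bar>V1 x - V1 0\<bar>"
      using V1_increment[of 0 x] V1_increment[of x 0] by (cases "0 \<le> x") auto
    ultimately show ?thesis by linarith
  qed
  have "continuous_on {-R..R} u"
    by (meson DERIV_isCont continuous_at_imp_continuous_on du)
  then have "bounded (u ` {-R..R})"
    by (intro compact_imp_bounded compact_continuous_image) auto
  then obtain C where C: "\<And>x. x \<in> {-R..R} \<Longrightarrow> \<bar>u x\<bar> \<le> C"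
    unfolding bounded_iff by (metis imageI real_norm_def)
  have "\<bar>u x\<bar> \<le> max B C" for x
  proof (cases "x \<in> {-R..R}")
    case False
    have "1 * \<bar>u x\<bar> \<le> \<bar>V1 x\<bar> * \<bar>u x\<bar>" using V1_big[OF False] by (intro mult_right_mono) auto
    then show ?thesis using Vu[of x] by (simp add: abs_mult)
  qed (use C in fastforce)
  then show ?thesis using that du Vu by blast
qed

text \<open>The class in which the induction runs: it contains the test functions and is stable
  under passing from f to the solution u. Compact support would be lost on subtracting the
  mean.\<close>

definition bounded_C1 :: "(real \<Rightarrow> real) \<Rightarrow> (real \<Rightarrow> real) \<Rightarrow> bool" where
  "bounded_C1 f f' \<longleftrightarrow> (\<forall>x. (f has_real_derivative f' x) (at x)) \<and> continuous_on UNIV f'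
     \<and> (\<exists>B. \<forall>x. \<bar>f x\<bar> \<le> B) \<and> (\<exists>B. \<forall>x. \<bar>f' x\<bar> \<le> B)"

lemma bounded_C1D:
  assumes "bounded_C1 f f'"
  shows "(f has_real_derivative f' x) (at x)" "continuous_on UNIV f" "continuous_on UNIV f'"
    "poly_growth f" "poly_growth f'"
  using assms unfolding bounded_C1_def
  by (auto intro: poly_growth_bounded DERIV_isCont continuous_at_imp_continuous_on)

lemma E_diff_const_square:
  assumes "poly_growth f" "continuous_on UNIV f"
  shows "E (\<lambda>x. (f x - E f)\<^sup>2) = E (\<lambda>x. (f x)\<^sup>2) - (E f)\<^sup>2"
proof -
  have int: "integrable (mu V) f" "integrable (mu V) (\<lambda>x. (f x)\<^sup>2)"
    using assms by (auto intro!: integrable_mu_continuous poly_growth_intros continuous_intros)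
  have "E (\<lambda>x. (f x - E f)\<^sup>2) = E (\<lambda>x. (f x)\<^sup>2 - 2 * E f * f x + (E f)\<^sup>2)"
    by (simp add: power2_diff algebra_simps)
  also have "\<dots> = E (\<lambda>x. (f x)\<^sup>2) - 2 * E f * E f + (E f)\<^sup>2"
    using int by simp
  finally show ?thesis by (simp add: power2_eq_square)
qed

text \<open>Here u solves V' u - u' = f - E f. The first identity is adjointness, the inequality is
  the commutation relation combined with V'' >= r, and the last identity pairs the equation with
  x^(i+1), lowering the degree of the moments by one.\<close>

lemma adjoint_derivative_identities:
  assumes f: "bounded_C1 f f'"
  obtains u u' where "bounded_C1 u u'"
    and "E (\<lambda>x. (f x - E f)\<^sup>2) = E (\<lambda>x. f' x * u x)"
    and "E (\<lambda>x. (u' x)\<^sup>2) + r * E (\<lambda>x. (u x)\<^sup>2) \<le> E (\<lambda>x. (f x - E f)\<^sup>2)"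
    and "\<And>i. real (Suc i) * E (\<lambda>x. u x * x ^ i) = E (\<lambda>x. f x * x ^ Suc i) - E f * E (\<lambda>x. x ^ Suc i)"
proof -
  define f0 where "f0 x = f x - E f" for x
  note f_D = bounded_C1D[OF f]
  have int_f: "integrable (mu V) f" by (intro integrable_mu_continuous f_D)
  have df0: "(f0 has_real_derivative f' x) (at x)" for x
    unfolding f0_def by (auto intro!: derivative_eq_intros f_D)
  have f0_cont: "continuous_on UNIV f0" unfolding f0_def by (intro continuous_intros f_D)
  have f0_pg: "poly_growth f0" unfolding f0_def by (intro poly_growth_intros f_D)
  have "E f0 = 0" unfolding f0_def using int_f by simp
  moreover obtain B where B: "\<And>x. \<bar>f0 x\<bar> \<le> B"
  proof -
    obtain B where B: "\<And>x. \<bar>f x\<bar> \<le> B" using f unfolding bounded_C1_def by blast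
    have "\<bar>f0 x\<bar> \<le> B + \<bar>E f\<bar>" for x using B[of x] unfolding f0_def by linarith
    then show ?thesis by (rule that)
  qed
  ultimately obtain u where du: "\<And>x. (u has_real_derivative V1 x * u x - f0 x) (at x)"
    and Vu: "\<And>x. \<bar>V1 x * u x\<bar> \<le> B" and "\<exists>C. \<forall>x. \<bar>u x\<bar> \<le> C"
    using adjoint_derivative_solvable[OF f0_cont B] by blast
  define u' where "u' x = V1 x * u x - f0 x" for x
  have u_cont: "continuous_on UNIV u" by (meson DERIV_isCont continuous_at_imp_continuous_on du)
  have u'_cont: "continuous_on UNIV u'" unfolding u'_def by (intro continuous_intros u_cont f0_cont continuous_V1)
  have "\<bar>u' x\<bar> \<le> 2 * B" for x using Vu[of x] B[of x] unfolding u'_def by linarith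
  then have u: "bounded_C1 u u'"
    unfolding bounded_C1_def using du u'_cont \<open>\<exists>C. \<forall>x. \<bar>u x\<bar> \<le> C\<close> by (auto simp: u'_def)
  \<comment> \<open>V' may grow arbitrarily fast; the boundedness of the product V' u is what makes
    the integrals below converge.\<close>
  have Vu_pg: "poly_growth (\<lambda>x. V1 x * u x)" using Vu by (rule poly_growth_bounded)
  note u_D = bounded_C1D[OF u]
  note facts = f0_cont f0_pg f_D(2-) u_D(2-) Vu_pg

  have "E (\<lambda>x. f' x * u x - (f0 x)\<^sup>2) = 0"
  proof (rule integration_by_parts)
    show "((\<lambda>x. f0 x * u x) has_real_derivative f' x * u x + f0 x * u' x) (at x)" for x
      by (auto intro!: derivative_eq_intros df0 u_D)
    show "f' x * u x + f0 x * u' x - V1 x * (f0 x * u x) = f' x * u x - (f0 x)\<^sup>2" for x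
      by (simp add: u'_def power2_eq_square algebra_simps)
  qed (intro continuous_intros poly_growth_intros facts)+
  moreover have "integrable (mu V) (\<lambda>x. f' x * u x)" "integrable (mu V) (\<lambda>x. (f0 x)\<^sup>2)"
    by (intro integrable_mu_continuous continuous_intros poly_growth_intros facts)+
  ultimately have 1: "E (\<lambda>x. (f0 x)\<^sup>2) = E (\<lambda>x. f' x * u x)" by simp

  \<comment> \<open>Integrating by parts with V' u^2 produces u'^2 + V'' u^2 - (V' u - u')^2, and
    V'' is then replaced by r.\<close>
  have "E (\<lambda>x. (u' x)\<^sup>2 + r * (u x)\<^sup>2 - (f0 x)\<^sup>2) \<le> 0"
  proof (rule integration_by_parts_le)
    show "((\<lambda>x. V1 x * u x * u x) has_real_derivative
        (V2 x * u x + V1 x * u' x) * u x + V1 x * u x * u' x) (at x)" for x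
      by (auto intro!: derivative_eq_intros u_D dV1 simp: algebra_simps)
    show "(u' x)\<^sup>2 + r * (u x)\<^sup>2 - (f0 x)\<^sup>2
        \<le> (V2 x * u x + V1 x * u' x) * u x + V1 x * u x * u' x - V1 x * (V1 x * u x * u x)" for x
    proof -
      have "r * (u x)\<^sup>2 \<le> V2 x * (u x)\<^sup>2" by (intro mult_right_mono V2_ge) simp
      then show ?thesis by (simp add: u'_def power2_eq_square algebra_simps)
    qed
  qed (intro continuous_intros poly_growth_intros facts)+
  moreover have "integrable (mu V) (\<lambda>x. (u' x)\<^sup>2)" "integrable (mu V) (\<lambda>x. (u x)\<^sup>2)" "integrable (mu V) (\<lambda>x. (f0 x)\<^sup>2)"
    by (intro integrable_mu_continuous continuous_intros poly_growth_intros facts)+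
  ultimately have 2: "E (\<lambda>x. (u' x)\<^sup>2) + r * E (\<lambda>x. (u x)\<^sup>2) \<le> E (\<lambda>x. (f0 x)\<^sup>2)" by simp

  have 3: "real (Suc i) * E (\<lambda>x. u x * x ^ i) = E (\<lambda>x. f x * x ^ Suc i) - E f * E (\<lambda>x. x ^ Suc i)" for i
  proof -
    have "E (\<lambda>x. real (Suc i) * (u x * x ^ i) - (f x * x ^ Suc i - E f * x ^ Suc i)) = 0"
    proof (rule integration_by_parts)
      show "((\<lambda>x. x ^ Suc i * u x) has_real_derivative real (Suc i) * x ^ i * u x + x ^ Suc i * u' x) (at x)" for x
        by (rule derivative_eq_intros u_D refl)+ (simp add: algebra_simps)
      show "real (Suc i) * x ^ i * u x + x ^ Suc i * u' x - V1 x * (x ^ Suc i * u x)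
          = real (Suc i) * (u x * x ^ i) - (f x * x ^ Suc i - E f * x ^ Suc i)" for x
        by (simp add: u'_def f0_def algebra_simps)
    qed (intro continuous_intros poly_growth_intros facts)+
    moreover have "integrable (mu V) (\<lambda>x. u x * x ^ i)" "integrable (mu V) (\<lambda>x. f x * x ^ Suc i)"
      "integrable (mu V) (\<lambda>x. x ^ Suc i)"
      by (intro integrable_mu_continuous continuous_intros poly_growth_intros facts)+
    ultimately show ?thesis by (simp del: power_Suc of_nat_Suc)
  qed
  show ?thesis using that[OF u] 1 2 3 unfolding f0_def by blast
qed

text \<open>For \<open>f\<close> orthogonal to \<open>1, x, \<dots>, x ^ (n - 1)\<close> the error term vanishes.  Keeping the
  error term lets the inequality pass to \<open>L\<^sup>2\<close> limits of functions that are only approximately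
  orthogonal.\<close>

lemma energy_ge_with_moment_error:
  "\<exists>C\<ge>0. \<forall>f f'. bounded_C1 f f' \<longrightarrow>
     real n * r * E (\<lambda>x. (f x)\<^sup>2) - C * (\<Sum>i<n. (E (\<lambda>x. f x * x ^ i))\<^sup>2) \<le> E (\<lambda>x. (f' x)\<^sup>2)"
proof (induction n)
  case 0
  show ?case by (auto intro!: exI[of _ 0])
next
  case (Suc n)
  then obtain C where C: "0 \<le> C" and IH: "\<And>f f'. bounded_C1 f f' \<Longrightarrow>
     real n * r * E (\<lambda>x. (f x)\<^sup>2) - C * (\<Sum>i<n. (E (\<lambda>x. f x * x ^ i))\<^sup>2) \<le> E (\<lambda>x. (f' x)\<^sup>2)"
    by blast
  define N where "N = real (Suc n) * r"
  have "0 < N" using r_pos by (simp add: N_def)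
  \<comment> \<open>Chosen so that \<open>C\<close> times the sum of squared moments of u is at most
    \<open>D\<close> times the sum \<open>S\<close> of squared moments of f.\<close>
  define D where "D = C * (2 + 2 * (\<Sum>i<n. (E (\<lambda>x. x ^ Suc i))\<^sup>2))"
  have "0 \<le> D" using C by (auto simp: D_def intro!: mult_nonneg_nonneg add_nonneg_nonneg sum_nonneg)
  \<comment> \<open>In the coefficient, N D comes from the error of the induction hypothesis, and N
    from replacing the variance by the second moment, since the square of the mean is the term i = 0
    of the sum.\<close>
  have "N * E (\<lambda>x. (f x)\<^sup>2) - N * (1 + D) * (\<Sum>i<Suc n. (E (\<lambda>x. f x * x ^ i))\<^sup>2) \<le> E (\<lambda>x. (f' x)\<^sup>2)"
    if f: "bounded_C1 f f'" for f f'
  proof -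
    obtain u u' where u: "bounded_C1 u u'"
      and eq1: "E (\<lambda>x. (f x - E f)\<^sup>2) = E (\<lambda>x. f' x * u x)"
      and le2: "E (\<lambda>x. (u' x)\<^sup>2) + r * E (\<lambda>x. (u x)\<^sup>2) \<le> E (\<lambda>x. (f x - E f)\<^sup>2)"
      and eq3: "\<And>i. real (Suc i) * E (\<lambda>x. u x * x ^ i) = E (\<lambda>x. f x * x ^ Suc i) - E f * E (\<lambda>x. x ^ Suc i)"
      using adjoint_derivative_identities[OF f] by blast
    note facts = bounded_C1D(2-)[OF f] bounded_C1D(2-)[OF u]
    define a where "a = E (\<lambda>x. (f x - E f)\<^sup>2)"
    define S where "S = (\<Sum>i<Suc n. (E (\<lambda>x. f x * x ^ i))\<^sup>2)"
    have S_eq: "S = (E f)\<^sup>2 + (\<Sum>i<n. (E (\<lambda>x. f x * x ^ Suc i))\<^sup>2)"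
      unfolding S_def by (subst sum.lessThan_Suc_shift) simp
    have a_eq: "a = E (\<lambda>x. (f x)\<^sup>2) - (E f)\<^sup>2"
      unfolding a_def by (intro E_diff_const_square facts)
    have "0 \<le> a" by (simp add: a_def)
    have "0 \<le> S" unfolding S_def by (intro sum_nonneg) simp
    have moment: "(E (\<lambda>x. u x * x ^ i))\<^sup>2
        \<le> 2 * (E (\<lambda>x. f x * x ^ Suc i))\<^sup>2 + 2 * (E f)\<^sup>2 * (E (\<lambda>x. x ^ Suc i))\<^sup>2" for i
    proof -
      define m p q where "m = E (\<lambda>x. u x * x ^ i)" and "p = E (\<lambda>x. f x * x ^ Suc i)" and "q = E f * E (\<lambda>x. x ^ Suc i)"
      have "1 * \<bar>m\<bar> \<le> real (Suc i) * \<bar>m\<bar>" by (intro mult_right_mono) auto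
      also have "\<dots> = \<bar>p - q\<bar>" using eq3[of i] unfolding m_def p_def q_def by (metis abs_mult abs_of_nat)
      finally have "m\<^sup>2 \<le> (p - q)\<^sup>2" by (simp flip: abs_le_square_iff)
      also have "\<dots> \<le> 2 * p\<^sup>2 + 2 * q\<^sup>2"
        using zero_le_power2[of "p + q"] by (simp add: power2_eq_square algebra_simps)
      finally show ?thesis by (simp add: m_def p_def q_def power_mult_distrib)
    qed
    have "(\<Sum>i<n. (E (\<lambda>x. u x * x ^ i))\<^sup>2)
        \<le> (\<Sum>i<n. 2 * (E (\<lambda>x. f x * x ^ Suc i))\<^sup>2 + 2 * (E f)\<^sup>2 * (E (\<lambda>x. x ^ Suc i))\<^sup>2)"
      by (intro sum_mono moment)
    also have "\<dots> = 2 * (\<Sum>i<n. (E (\<lambda>x. f x * x ^ Suc i))\<^sup>2) + 2 * (\<Sum>i<n. (E (\<lambda>x. x ^ Suc i))\<^sup>2) * (E f)\<^sup>2"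
      by (simp add: sum.distrib sum_distrib_left sum_distrib_right mult_ac del: power_Suc)
    also have "\<dots> \<le> 2 * S + 2 * (\<Sum>i<n. (E (\<lambda>x. x ^ Suc i))\<^sup>2) * S"
      by (intro add_mono mult_left_mono) (auto simp: S_eq intro!: sum_nonneg)
    also have "\<dots> = (2 + 2 * (\<Sum>i<n. (E (\<lambda>x. x ^ Suc i))\<^sup>2)) * S" by (simp add: algebra_simps)
    finally have err: "C * (\<Sum>i<n. (E (\<lambda>x. u x * x ^ i))\<^sup>2) \<le> D * S"
      unfolding D_def mult.assoc using C by (rule mult_left_mono)
    have u_le: "N * E (\<lambda>x. (u x)\<^sup>2) \<le> a + D * S"
      using IH[OF u] le2 err by (simp add: a_def N_def algebra_simps)
    have "a\<^sup>2 \<le> E (\<lambda>x. (f' x)\<^sup>2) * E (\<lambda>x. (u x)\<^sup>2)"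
      unfolding a_def eq1
      by (intro integral_Cauchy_Schwarz integrable_mu_continuous poly_growth_intros continuous_intros facts)
         (simp_all add: measurable_cong_sets[OF sets_mu refl] borel_measurable_continuous_onI facts)
    then have "N * a\<^sup>2 \<le> N * (E (\<lambda>x. (f' x)\<^sup>2) * E (\<lambda>x. (u x)\<^sup>2))"
      using \<open>0 < N\<close> by simp
    also have "\<dots> = E (\<lambda>x. (f' x)\<^sup>2) * (N * E (\<lambda>x. (u x)\<^sup>2))" by simp
    also have "\<dots> \<le> E (\<lambda>x. (f' x)\<^sup>2) * (a + D * S)"
      using u_le by (rule mult_left_mono) simp
    finally have "N * a\<^sup>2 \<le> E (\<lambda>x. (f' x)\<^sup>2) * (a + D * S)" .
    \<comment> \<open>Lowering a^2 to a^2 - (D S)^2 creates the common factor a + D S, which can be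
      cancelled and leaves an error linear in S.\<close>
    moreover have "N * (a - D * S) * (a + D * S) \<le> N * a\<^sup>2"
    proof -
      have "N * (a - D * S) * (a + D * S) = N * (a\<^sup>2 - (D * S)\<^sup>2)"
        by (simp add: power2_eq_square algebra_simps)
      then show ?thesis using \<open>0 < N\<close> by simp
    qed
    ultimately have le: "N * (a - D * S) * (a + D * S) \<le> E (\<lambda>x. (f' x)\<^sup>2) * (a + D * S)" by linarith
    have "0 \<le> D * S" using \<open>0 \<le> D\<close> \<open>0 \<le> S\<close> by simp
    have "N * (a - D * S) \<le> E (\<lambda>x. (f' x)\<^sup>2)"
    proof (cases "a + D * S = 0")
      case True
      then have "a = 0" "D * S = 0"
        using \<open>0 \<le> a\<close> \<open>0 \<le> D * S\<close> by linarith+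
      then show ?thesis by (simp only: diff_self mult_zero_right) simp
    next
      case False
      then have "0 < a + D * S" using \<open>0 \<le> a\<close> \<open>0 \<le> D * S\<close> by linarith
      with le show ?thesis by simp
    qed
    moreover have "N * (E f)\<^sup>2 \<le> N * S"
      using \<open>0 < N\<close> by (intro mult_left_mono) (auto simp: S_eq intro!: sum_nonneg)
    ultimately show ?thesis
      unfolding S_def[symmetric] a_eq by (simp add: algebra_simps)
  qed
  moreover have "0 \<le> N * (1 + D)" using \<open>0 < N\<close> \<open>0 \<le> D\<close> by simp
  ultimately show ?case unfolding N_def by blast
qed

end

section \<open>The max-min values\<close>

context uniformly_convex
begin

section \<open>From test functions to the closed operator, and the lower bound\<close>

lemma deriv_V: "deriv V = V1"
  by (intro ext DERIV_imp_deriv dV)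

lemma borel_measurable_mu [simp]: "borel_measurable (mu V) = borel_measurable borel"
  by (rule measurable_cong_sets) simp_all

lemma poly_growth_L2: "poly_growth f \<Longrightarrow> f \<in> borel_measurable borel \<Longrightarrow> f \<in> L2 V"
  by (simp add: L2_def integrable_mu_poly_growth poly_growth_power)

lemma Lop_measurable: "smooth f \<Longrightarrow> Lop V f \<in> borel_measurable borel"
  unfolding Lop_def deriv_V
  by (intro borel_measurable_diff borel_measurable_times V1_measurable smooth_borel_measurable smooth_deriv)

text \<open>Integration by parts with f f'. Growth hypotheses instead of compact support make it
  available both for test functions and for polynomials.\<close>

lemma energy_identity:
  assumes f: "smooth f" and pg: "poly_growth f" "poly_growth (deriv f)" "poly_growth (Lop V f)"
  shows "E (\<lambda>x. f x * - Lop V f x) = E (\<lambda>x. (deriv f x)\<^sup>2)"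
proof -
  have L_cont: "continuous_on UNIV (Lop V f)"
    unfolding Lop_def deriv_V
    by (intro continuous_intros continuous_V1 smooth_continuous_on smooth_deriv f)
  note facts = pg L_cont smooth_continuous_on[OF f] smooth_continuous_on[OF smooth_deriv[OF f]]
  have "E (\<lambda>x. (deriv f x)\<^sup>2 + f x * Lop V f x) = 0"
  proof (rule integration_by_parts)
    show "((\<lambda>x. f x * deriv f x) has_real_derivative deriv f x * deriv f x + f x * deriv (deriv f) x) (at x)" for x
      by (auto intro!: derivative_eq_intros smooth_has_deriv smooth_deriv f)
    show "deriv f x * deriv f x + f x * deriv (deriv f) x - V1 x * (f x * deriv f x)
        = (deriv f x)\<^sup>2 + f x * Lop V f x" for x
      by (simp add: Lop_def deriv_V power2_eq_square algebra_simps)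
  qed (intro continuous_intros poly_growth_intros facts)+
  moreover have "integrable (mu V) (\<lambda>x. (deriv f x)\<^sup>2)" "integrable (mu V) (\<lambda>x. f x * Lop V f x)"
    by (intro integrable_mu_continuous continuous_intros poly_growth_intros facts)+
  ultimately show ?thesis by simp
qed

lemma test_fun_bounded_C1: "test_fun \<phi> \<Longrightarrow> bounded_C1 \<phi> (deriv \<phi>)"
  unfolding bounded_C1_def
  by (metis test_fun_bounded test_fun_deriv test_fun_def smooth_has_deriv smooth_continuous_on smooth_deriv)

text \<open>The product V' \<phi>' is continuous with compact support, hence bounded however fast V'
  grows.\<close>

lemma test_fun_Lop_poly_growth:
  assumes "test_fun \<phi>"
  shows "poly_growth (Lop V \<phi>)"
proof -
  have \<phi>': "test_fun (deriv \<phi>)" "test_fun (deriv (deriv \<phi>))" using assms test_fun_deriv by auto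
  have "bounded {x. V1 x * deriv \<phi> x \<noteq> 0}"
    using \<phi>'(1) by (auto simp: test_fun_def elim: bounded_subset)
  moreover have "continuous_on UNIV (\<lambda>x. V1 x * deriv \<phi> x)"
    using \<phi>'(1) by (intro continuous_intros continuous_V1 smooth_continuous_on) (simp add: test_fun_def)
  ultimately obtain B where "\<And>x. \<bar>V1 x * deriv \<phi> x\<bar> \<le> B"
    using compact_support_bounded[of "\<lambda>x. V1 x * deriv \<phi> x"] by (auto simp del: mult_eq_0_iff)
  moreover obtain B' where "\<And>x. \<bar>deriv (deriv \<phi>) x\<bar> \<le> B'"
    using test_fun_bounded[OF \<phi>'(2)] by blast
  ultimately have "poly_growth (\<lambda>x. V1 x * deriv \<phi> x)" "poly_growth (deriv (deriv \<phi>))"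
    by (auto intro: poly_growth_bounded)
  then show ?thesis unfolding Lop_def deriv_V by (intro poly_growth_diff)
qed

text \<open>The inequality with moment error passes to the limit along test functions approximating
  (f, g) in the graph norm. Energies are written as E(\<phi> (-L \<phi>)), so no derivative of f has
  to be defined, and the moments converge to those of f, which vanish.\<close>

lemma L_graph_energy_ge:
  assumes fg: "(f, g) \<in> L_graph V" and orth: "\<And>i. i < n \<Longrightarrow> E (\<lambda>x. f x * x ^ i) = 0"
  shows "real n * r * E (\<lambda>x. (f x)\<^sup>2) \<le> E (\<lambda>x. f x * - g x)"
proof -
  from fg obtain \<phi> where \<phi>: "\<And>k. test_fun (\<phi> k)"
    and lim_f: "(\<lambda>k. E (\<lambda>x. (\<phi> k x - f x)\<^sup>2)) \<longlonglongrightarrow> 0"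
    and lim_g: "(\<lambda>k. E (\<lambda>x. (Lop V (\<phi> k) x - g x)\<^sup>2)) \<longlonglongrightarrow> 0"
    and f: "f \<in> L2 V" and g: "g \<in> L2 V"
    unfolding L_graph_def by blast
  obtain C where C: "\<And>f f'. bounded_C1 f f' \<Longrightarrow>
     real n * r * E (\<lambda>x. (f x)\<^sup>2) - C * (\<Sum>i<n. (E (\<lambda>x. f x * x ^ i))\<^sup>2) \<le> E (\<lambda>x. (f' x)\<^sup>2)"
    using energy_ge_with_moment_error[of n] by blast
  have sm: "smooth (\<phi> k)" for k using \<phi> by (simp add: test_fun_def)
  note \<phi>_C1 = bounded_C1D[OF test_fun_bounded_C1[OF \<phi>]]
  have \<phi>_L2: "\<phi> k \<in> L2 V" for k
    by (intro poly_growth_L2 \<phi>_C1 smooth_borel_measurable sm)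
  have L\<phi>_L2: "Lop V (\<phi> k) \<in> L2 V" for k
    by (intro poly_growth_L2 test_fun_Lop_poly_growth Lop_measurable \<phi> sm)
  have x_L2: "(\<lambda>x. x ^ i) \<in> L2 V" for i
    by (intro poly_growth_L2 poly_growth_intros) simp
  note L2s = f g \<phi>_L2 L\<phi>_L2 x_L2
  have "(\<lambda>k. E (\<lambda>x. \<phi> k x * \<phi> k x)) \<longlonglongrightarrow> E (\<lambda>x. f x * f x)"
    using L2s by (intro tendsto_integral_mult_L2 lim_f) (simp_all add: L2_def)
  then have 1: "(\<lambda>k. E (\<lambda>x. (\<phi> k x)\<^sup>2)) \<longlonglongrightarrow> E (\<lambda>x. (f x)\<^sup>2)" by (simp add: power2_eq_square)
  have "(\<lambda>k. E (\<lambda>x. \<phi> k x * Lop V (\<phi> k) x)) \<longlonglongrightarrow> E (\<lambda>x. f x * g x)"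
    using L2s by (intro tendsto_integral_mult_L2 lim_f lim_g) (simp_all add: L2_def)
  then have "(\<lambda>k. E (\<lambda>x. \<phi> k x * - Lop V (\<phi> k) x)) \<longlonglongrightarrow> E (\<lambda>x. f x * - g x)"
    by (simp add: tendsto_minus)
  moreover have "E (\<lambda>x. \<phi> k x * - Lop V (\<phi> k) x) = E (\<lambda>x. (deriv (\<phi> k) x)\<^sup>2)" for k
    by (intro energy_identity sm \<phi>_C1 test_fun_Lop_poly_growth \<phi>)
  ultimately have 2: "(\<lambda>k. E (\<lambda>x. (deriv (\<phi> k) x)\<^sup>2)) \<longlonglongrightarrow> E (\<lambda>x. f x * - g x)" by simp
  have 3: "(\<lambda>k. E (\<lambda>x. \<phi> k x * x ^ i)) \<longlonglongrightarrow> E (\<lambda>x. f x * x ^ i)" for i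
    using L2s by (intro tendsto_integral_mult_L2 lim_f) (simp_all add: L2_def)
  have "(\<lambda>k. real n * r * E (\<lambda>x. (\<phi> k x)\<^sup>2) - C * (\<Sum>i<n. (E (\<lambda>x. \<phi> k x * x ^ i))\<^sup>2))
      \<longlonglongrightarrow> real n * r * E (\<lambda>x. (f x)\<^sup>2) - C * (\<Sum>i<n. (E (\<lambda>x. f x * x ^ i))\<^sup>2)"
    by (intro tendsto_intros 1 3)
  from LIMSEQ_le[OF this 2] have
    "real n * r * E (\<lambda>x. (f x)\<^sup>2) - C * (\<Sum>i<n. (E (\<lambda>x. f x * x ^ i))\<^sup>2) \<le> E (\<lambda>x. f x * - g x)"
    using C test_fun_bounded_C1[OF \<phi>] by blast
  then show ?thesis using orth by simp
qed

text \<open>The supremum is tested with the functions 1, x, ..., x^(n-1).\<close>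

lemma lambda_n_ge: "ereal (real n * r) \<le> lambda_n V n"
  unfolding lambda_n_def
proof (rule SUP_upper2)
  show "(\<lambda>i x. x ^ i) \<in> {gs. \<forall>i<n. gs i \<in> L2 V}"
    by (auto intro!: poly_growth_L2 poly_growth_intros)
  show "ereal (real n * r) \<le> (INF fg \<in> {(f, g). (f, g) \<in> L_graph V \<and> E (\<lambda>x. (f x)\<^sup>2) \<noteq> 0 \<and>
      (\<forall>i<n. E (\<lambda>x. f x * x ^ i) = 0)}. ereal (E (\<lambda>x. fst fg x * - snd fg x) / E (\<lambda>x. (fst fg x)\<^sup>2)))"
  proof (rule INF_greatest, clarsimp)
    fix f g assume *: "(f, g) \<in> L_graph V" "E (\<lambda>x. (f x)\<^sup>2) \<noteq> 0" "\<forall>i<n. E (\<lambda>x. f x * x ^ i) = 0"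
    have "0 \<le> E (\<lambda>x. (f x)\<^sup>2)" by simp
    with *(2) have "0 < E (\<lambda>x. (f x)\<^sup>2)" by linarith
    then show "real n * r \<le> - (E (\<lambda>x. f x * g x) / E (\<lambda>x. (f x)\<^sup>2))"
      using L_graph_energy_ge[OF *(1), of n] *(3) by (simp add: field_simps)
  qed
qed

section \<open>Polynomials in the domain and the upper bound\<close>

text \<open>The cutoffs f(x) \<open>\<eta>\<close>(x/(k+1)) converge to f in the graph norm by
  dominated convergence. This places polynomials in the domain of the closed operator when V' has
  polynomial growth.\<close>

lemma cutoff_L_graph:
  assumes f: "smooth f"
    and pg: "poly_growth f" "poly_growth (deriv f)" "poly_growth (deriv (deriv f))" "poly_growth V1"
  shows "(f, Lop V f) \<in> L_graph V"
proof -
  obtain \<eta> where \<eta>: "test_fun \<eta>" "\<eta> 0 = 1" using ex_test_fun_eq_1_at_0 by blast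
  have \<eta>': "test_fun (deriv \<eta>)" "test_fun (deriv (deriv \<eta>))" using \<eta>(1) test_fun_deriv by auto
  have sm\<eta>: "smooth \<eta>" using \<eta>(1) by (simp add: test_fun_def)
  obtain B0 B1 B2 where "\<And>x. \<bar>\<eta> x\<bar> \<le> B0" "\<And>x. \<bar>deriv \<eta> x\<bar> \<le> B1" "\<And>x. \<bar>deriv (deriv \<eta>) x\<bar> \<le> B2"
    using test_fun_bounded \<eta>(1) \<eta>' by metis
  define B where "B = 1 + \<bar>B0\<bar> + \<bar>B1\<bar> + \<bar>B2\<bar>"
  have B: "\<bar>\<eta> x - 1\<bar> \<le> B" "\<bar>deriv \<eta> x\<bar> \<le> B" "\<bar>deriv (deriv \<eta>) x\<bar> \<le> B" for x
    using \<open>\<bar>\<eta> x\<bar> \<le> B0\<close> \<open>\<bar>deriv \<eta> x\<bar> \<le> B1\<close> \<open>\<bar>deriv (deriv \<eta>) x\<bar> \<le> B2\<close> by (auto simp: B_def)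
  have "0 \<le> B" using B(2)[of 0] by linarith
  define a where "a k = inverse (real (Suc k))" for k
  have a: "a k \<noteq> 0" "0 \<le> a k" "a k \<le> 1" for k by (auto simp: a_def inverse_le_1_iff)
  have a_lim: "a \<longlonglongrightarrow> 0" unfolding a_def by (rule LIMSEQ_inverse_real_of_nat)
  define \<phi> where "\<phi> k x = f x * \<eta> (a k * x)" for k x
  have \<phi>: "test_fun (\<phi> k)" for k
    unfolding \<phi>_def by (intro test_fun_cutoff f \<eta> a)
  have sm\<phi>: "smooth (\<phi> k)" for k using \<phi> by (simp add: test_fun_def)
  have d1: "deriv (\<phi> k) = (\<lambda>x. deriv f x * \<eta> (a k * x) + a k * f x * deriv \<eta> (a k * x))" for k
    unfolding \<phi>_def
    by (intro ext DERIV_imp_deriv)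
       (auto intro!: derivative_eq_intros smooth_has_deriv f DERIV_chain2[OF smooth_has_deriv[OF sm\<eta>]])
  have d2: "deriv (deriv (\<phi> k)) x = deriv (deriv f) x * \<eta> (a k * x) + 2 * a k * deriv f x * deriv \<eta> (a k * x)
      + (a k)\<^sup>2 * f x * deriv (deriv \<eta>) (a k * x)" for k x
    unfolding d1
    by (intro DERIV_imp_deriv)
       (auto intro!: derivative_eq_intros smooth_has_deriv smooth_deriv f DERIV_chain2[OF smooth_has_deriv[OF sm\<eta>]]
         DERIV_chain2[OF smooth_has_deriv[OF smooth_deriv[OF sm\<eta>]]] simp: power2_eq_square algebra_simps)
  have \<eta>_lim: "(\<lambda>k. \<eta> (a k * x)) \<longlonglongrightarrow> 1" "(\<lambda>k. deriv \<eta> (a k * x)) \<longlonglongrightarrow> deriv \<eta> 0"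
      "(\<lambda>k. deriv (deriv \<eta>) (a k * x)) \<longlonglongrightarrow> deriv (deriv \<eta>) 0" for x
  proof -
    have ax: "(\<lambda>k. a k * x) \<longlonglongrightarrow> 0" using tendsto_mult_left_zero[OF a_lim] by simp
    have lim: "(\<lambda>k. g (a k * x)) \<longlonglongrightarrow> g 0" if "smooth g" for g
      using isCont_tendsto_compose[OF DERIV_isCont[OF smooth_has_deriv[OF that]] ax] .
    show "(\<lambda>k. \<eta> (a k * x)) \<longlonglongrightarrow> 1" "(\<lambda>k. deriv \<eta> (a k * x)) \<longlonglongrightarrow> deriv \<eta> 0"
      "(\<lambda>k. deriv (deriv \<eta>) (a k * x)) \<longlonglongrightarrow> deriv (deriv \<eta>) 0"
      using lim[of \<eta>] lim[of "deriv \<eta>"] lim[of "deriv (deriv \<eta>)"] \<eta>(2) sm\<eta> smooth_deriv by auto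
  qed
  have [measurable]: "f \<in> borel_measurable borel" "deriv f \<in> borel_measurable borel"
    "deriv (deriv f) \<in> borel_measurable borel" "Lop V f \<in> borel_measurable borel"
    "\<And>k. \<phi> k \<in> borel_measurable borel" "\<And>k. Lop V (\<phi> k) \<in> borel_measurable borel"
    by (intro smooth_borel_measurable Lop_measurable smooth_deriv f sm\<phi>)+
  have abs_pg: "poly_growth (\<lambda>x. \<bar>h x\<bar>)" if "poly_growth h" for h
    using that by (rule poly_growth_mono) simp
  have dct: "(\<lambda>k. E (\<lambda>x. (F k x)\<^sup>2)) \<longlonglongrightarrow> 0"
    if [measurable]: "\<And>k. F k \<in> borel_measurable borel" "H \<in> borel_measurable borel"
      and "poly_growth H" and bd: "\<And>k x. \<bar>F k x\<bar> \<le> H x" and lim: "\<And>x. (\<lambda>k. F k x) \<longlonglongrightarrow> 0"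
    for F :: "nat \<Rightarrow> real \<Rightarrow> real" and H
  proof -
    have "(\<lambda>k. E (\<lambda>x. (F k x)\<^sup>2)) \<longlonglongrightarrow> E (\<lambda>x. 0)"
    proof (rule integral_dominated_convergence[where w = "\<lambda>x. (H x)\<^sup>2"])
      show "integrable (mu V) (\<lambda>x. (H x)\<^sup>2)"
        using \<open>poly_growth H\<close> by (intro integrable_mu_poly_growth poly_growth_power) auto
      show "AE x in mu V. (\<lambda>k. (F k x)\<^sup>2) \<longlonglongrightarrow> 0"
        using lim by (auto intro!: AE_I2 tendsto_eq_intros)
      show "AE x in mu V. norm ((F k x)\<^sup>2) \<le> (H x)\<^sup>2" for k
        using order_trans[OF bd[of k] abs_ge_self] by (auto simp flip: abs_le_square_iff)
    qed auto
    then show ?thesis by simp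
  qed
  have lim1: "(\<lambda>k. E (\<lambda>x. (\<phi> k x - f x)\<^sup>2)) \<longlonglongrightarrow> 0"
  proof (rule dct[where H = "\<lambda>x. B * \<bar>f x\<bar>"])
    show "\<bar>\<phi> k x - f x\<bar> \<le> B * \<bar>f x\<bar>" for k x
    proof -
      have "\<phi> k x - f x = (\<eta> (a k * x) - 1) * f x" by (simp add: \<phi>_def algebra_simps)
      then show ?thesis using B(1) by (simp add: abs_mult mult_right_mono)
    qed
    have "(\<lambda>k. f x * \<eta> (a k * x) - f x) \<longlonglongrightarrow> f x * 1 - f x" for x
      by (intro tendsto_intros \<eta>_lim)
    then show "(\<lambda>k. \<phi> k x - f x) \<longlonglongrightarrow> 0" for x by (simp add: \<phi>_def)
  qed (auto intro!: poly_growth_intros abs_pg pg)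
  have lim2: "(\<lambda>k. E (\<lambda>x. (Lop V (\<phi> k) x - Lop V f x)\<^sup>2)) \<longlonglongrightarrow> 0"
  proof (rule dct)
    define H where "H x = \<bar>deriv (deriv f) x\<bar> * B + 2 * \<bar>deriv f x\<bar> * B + \<bar>f x\<bar> * B
        + \<bar>V1 x\<bar> * (\<bar>deriv f x\<bar> * B + \<bar>f x\<bar> * B)" for x
    show "poly_growth H"
      unfolding H_def by (intro poly_growth_intros abs_pg pg)
    show "H \<in> borel_measurable borel" unfolding H_def by measurable
    have eq: "Lop V (\<phi> k) x - Lop V f x = deriv (deriv f) x * (\<eta> (a k * x) - 1)
        + 2 * a k * deriv f x * deriv \<eta> (a k * x) + (a k)\<^sup>2 * f x * deriv (deriv \<eta>) (a k * x)
        - V1 x * (deriv f x * (\<eta> (a k * x) - 1) + a k * f x * deriv \<eta> (a k * x))" for k x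
      unfolding Lop_def deriv_V d2 by (simp add: d1 algebra_simps)
    show "\<bar>Lop V (\<phi> k) x - Lop V f x\<bar> \<le> H x" for k x
    proof -
      have 1: "\<bar>c * h * y\<bar> \<le> \<bar>h\<bar> * B" if "\<bar>y\<bar> \<le> B" "0 \<le> c" "c \<le> 1" for c h y :: real
      proof -
        have "c * \<bar>h\<bar> * \<bar>y\<bar> \<le> 1 * \<bar>h\<bar> * B" using that \<open>0 \<le> B\<close> by (intro mult_mono) auto
        then show ?thesis using that by (simp add: abs_mult)
      qed
      have a2: "(a k)\<^sup>2 \<le> 1" using a[of k] by (simp add: power_le_one)
      have b1: "\<bar>deriv (deriv f) x * (\<eta> (a k * x) - 1)\<bar> \<le> \<bar>deriv (deriv f) x\<bar> * B"
        using 1[OF B(1), of 1] by simp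
      have b2: "\<bar>2 * a k * deriv f x * deriv \<eta> (a k * x)\<bar> \<le> 2 * \<bar>deriv f x\<bar> * B"
        using 1[OF B(2) a(2,3), of k "deriv f x" "a k * x"] by (simp add: abs_mult mult.assoc)
      have b3: "\<bar>(a k)\<^sup>2 * f x * deriv (deriv \<eta>) (a k * x)\<bar> \<le> \<bar>f x\<bar> * B"
        using 1[OF B(3) _ a2] by simp
      have b4: "\<bar>deriv f x * (\<eta> (a k * x) - 1)\<bar> \<le> \<bar>deriv f x\<bar> * B"
        using 1[OF B(1), of 1] by simp
      have b5: "\<bar>a k * f x * deriv \<eta> (a k * x)\<bar> \<le> \<bar>f x\<bar> * B"
        using 1[OF B(2) a(2,3)] .
      have "\<bar>V1 x * (deriv f x * (\<eta> (a k * x) - 1) + a k * f x * deriv \<eta> (a k * x))\<bar>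
          \<le> \<bar>V1 x\<bar> * (\<bar>deriv f x\<bar> * B + \<bar>f x\<bar> * B)"
        unfolding abs_mult[of "V1 x"] using b4 b5 by (intro mult_left_mono) linarith+
      then show ?thesis unfolding eq H_def using b1 b2 b3 by linarith
    qed
    have "(\<lambda>k. Lop V (\<phi> k) x - Lop V f x) \<longlonglongrightarrow> deriv (deriv f) x * (1 - 1)
        + 2 * 0 * deriv f x * deriv \<eta> 0 + 0\<^sup>2 * f x * deriv (deriv \<eta>) 0
        - V1 x * (deriv f x * (1 - 1) + 0 * f x * deriv \<eta> 0)" for x
      unfolding eq by (intro tendsto_intros \<eta>_lim a_lim)
    then show "(\<lambda>k. Lop V (\<phi> k) x - Lop V f x) \<longlonglongrightarrow> 0" for x by simp
  qed auto
  have "poly_growth (Lop V f)"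
    unfolding Lop_def deriv_V by (intro poly_growth_intros pg)
  then show ?thesis
    unfolding L_graph_def using \<phi> lim1 lim2 poly_growth_L2 pg(1) by auto
qed

text \<open>Induction on the degree bound. With q = p' and w = V' q - q', adjointness gives E(q^2) =
  E(p w), while V'' <= S and the hypothesis for q bound E(w^2) by (n + 1) S E(q^2); Cauchy-Schwarz
  closes the loop.\<close>

lemma poly_energy_le:
  assumes V2_le: "\<And>x. V2 x \<le> S" and V1_pg: "poly_growth V1"
  shows "degree p \<le> n \<Longrightarrow> E (\<lambda>x. (poly (pderiv p) x)\<^sup>2) \<le> real n * S * E (\<lambda>x. (poly p x)\<^sup>2)"
proof (induction n arbitrary: p)
  case 0
  then have "pderiv p = 0" by (simp add: pderiv_eq_0_iff)
  then show ?case by simp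
next
  case (Suc n)
  define q where "q = pderiv p"
  define A where "A = E (\<lambda>x. (poly q x)\<^sup>2)"
  define w where "w x = V1 x * poly q x - poly (pderiv q) x" for x
  have facts: "poly_growth w" "continuous_on UNIV w"
    unfolding w_def by (intro poly_growth_intros V1_pg continuous_intros continuous_V1)+
  have IH: "E (\<lambda>x. (poly (pderiv q) x)\<^sup>2) \<le> real n * S * A"
    unfolding A_def using Suc.prems by (intro Suc.IH) (simp add: q_def degree_pderiv)
  have "E (\<lambda>x. (poly q x)\<^sup>2 - poly p x * w x) = 0"
  proof (rule integration_by_parts)
    show "((\<lambda>x. poly p x * poly q x) has_real_derivative poly q x * poly q x + poly p x * poly (pderiv q) x) (at x)" for x
      unfolding q_def by (auto intro!: derivative_eq_intros poly_DERIV)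
    show "poly q x * poly q x + poly p x * poly (pderiv q) x - V1 x * (poly p x * poly q x)
        = (poly q x)\<^sup>2 - poly p x * w x" for x
      by (simp add: w_def power2_eq_square algebra_simps)
  qed (intro poly_growth_intros continuous_intros facts)+
  moreover have int: "integrable (mu V) (\<lambda>x. (poly q x)\<^sup>2)" "integrable (mu V) (\<lambda>x. poly p x * w x)"
    "integrable (mu V) (\<lambda>x. (poly (pderiv q) x)\<^sup>2)" "integrable (mu V) (\<lambda>x. (poly p x)\<^sup>2)" "integrable (mu V) (\<lambda>x. (w x)\<^sup>2)"
    by (intro integrable_mu_continuous poly_growth_intros continuous_intros facts)+
  ultimately have "A = E (\<lambda>x. poly p x * w x)" by (simp add: A_def)
  then have CS: "A\<^sup>2 \<le> E (\<lambda>x. (poly p x)\<^sup>2) * E (\<lambda>x. (w x)\<^sup>2)"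
    using int facts by (auto intro!: integral_Cauchy_Schwarz borel_measurable_continuous_onI continuous_intros)
  have w_le: "E (\<lambda>x. (w x)\<^sup>2) \<le> real (Suc n) * S * A"
  proof -
    \<comment> \<open>The same commutation as in the lower bound, now with -V' q^2, because V'' is
      bounded from above here.\<close>
    have "E (\<lambda>x. (w x)\<^sup>2 - (poly (pderiv q) x)\<^sup>2 - S * (poly q x)\<^sup>2) \<le> 0"
    proof (rule integration_by_parts_le)
      show "((\<lambda>x. - (V1 x * (poly q x)\<^sup>2)) has_real_derivative
          - (V2 x * (poly q x)\<^sup>2 + 2 * V1 x * poly q x * poly (pderiv q) x)) (at x)" for x
        by (auto intro!: derivative_eq_intros poly_DERIV dV1 simp: power2_eq_square algebra_simps)
      show "(w x)\<^sup>2 - (poly (pderiv q) x)\<^sup>2 - S * (poly q x)\<^sup>2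
          \<le> - (V2 x * (poly q x)\<^sup>2 + 2 * V1 x * poly q x * poly (pderiv q) x) - V1 x * - (V1 x * (poly q x)\<^sup>2)" for x
      proof -
        have "V2 x * (poly q x)\<^sup>2 \<le> S * (poly q x)\<^sup>2" by (intro mult_right_mono V2_le) simp
        then show ?thesis by (simp add: w_def power2_eq_square algebra_simps)
      qed
    qed (intro poly_growth_intros continuous_intros facts V1_pg)+
    then have "E (\<lambda>x. (w x)\<^sup>2) \<le> E (\<lambda>x. (poly (pderiv q) x)\<^sup>2) + S * A"
      using int by (simp add: A_def)
    then show ?thesis using IH by (simp add: algebra_simps)
  qed
  have "A * A \<le> (real (Suc n) * S * E (\<lambda>x. (poly p x)\<^sup>2)) * A"
    using order_trans[OF CS mult_left_mono[OF w_le]] by (simp add: power2_eq_square mult_ac)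
  moreover have "0 \<le> A" "0 \<le> E (\<lambda>x. (poly p x)\<^sup>2)" by (simp_all add: A_def)
  moreover have "0 < S" using V2_ge[of 0] V2_le[of 0] r_pos by linarith
  ultimately have "A \<le> real (Suc n) * S * E (\<lambda>x. (poly p x)\<^sup>2)"
    by (cases "A = 0") auto
  then show ?case by (simp add: A_def q_def)
qed

text \<open>The weight is positive and the roots form a finite, hence null, set. This makes nonzero
  polynomials admissible in the Rayleigh quotient.\<close>

lemma E_poly_square_nonzero:
  fixes p :: "real poly"
  assumes "p \<noteq> 0"
  shows "E (\<lambda>x. (poly p x)\<^sup>2) \<noteq> 0"
proof
  have meas: "(\<lambda>x. (poly p x)\<^sup>2) \<in> borel_measurable borel"
    by (intro borel_measurable_continuous_onI continuous_intros)
  assume "E (\<lambda>x. (poly p x)\<^sup>2) = 0"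
  then have "(\<integral>x. (poly p x)\<^sup>2 * exp (- V x) \<partial>lborel) = 0"
    using Z_pos by (simp add: integral_mu[OF meas])
  moreover have "integrable lborel (\<lambda>x. (poly p x)\<^sup>2 * exp (- V x))"
    by (intro integrable_weight poly_growth_intros meas)
  ultimately have "AE x in lborel. (poly p x)\<^sup>2 * exp (- V x) = 0"
    by (subst (asm) integral_nonneg_eq_0_iff_AE) auto
  moreover have "AE x in lborel. x \<notin> {x. poly p x = 0}"
    by (intro AE_not_in finite_imp_null_set_lborel poly_roots_finite assms)
  ultimately have "AE x in (lborel :: real measure). False"
    by eventually_elim simp
  then show False
    using ae_filter_eq_bot_iff[of "lborel :: real measure"] by (simp add: trivial_limit_def)
qed

text \<open>For every choice of the n constraint functions some nonzero polynomial of degree at most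
  n satisfies the constraints, and its Rayleigh quotient bounds the infimum.\<close>

lemma lambda_n_le:
  assumes V2_le: "\<And>x. V2 x \<le> S"
  shows "lambda_n V n \<le> ereal (real n * S)"
  unfolding lambda_n_def
proof (rule SUP_least)
  fix gs :: "nat \<Rightarrow> real \<Rightarrow> real" assume "gs \<in> {gs. \<forall>i<n. gs i \<in> L2 V}"
  then have gs: "gs i \<in> L2 V" if "i < n" for i using that by blast
  \<comment> \<open>Since 0 < r <= V'' <= S, the mean value inequality gives V' at most linear
    growth.\<close>
  have V1_pg: "poly_growth V1"
  proof (rule poly_growth_mono)
    show "poly_growth (\<lambda>x. \<bar>V1 0\<bar> + \<bar>S * x\<bar>)"
      by (intro poly_growth_intros poly_growth_mono[of "\<lambda>x. S * x"]) simp_all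
    fix x
    have "\<bar>V2 z\<bar> \<le> S" for z using V2_ge[of z] V2_le[of z] r_pos by linarith
    then have "norm (V1 x - V1 0) \<le> S * norm (x - 0)"
      by (intro field_differentiable_bound[of UNIV V1 V2]) (auto intro: dV1)
    moreover have "0 \<le> S" using V2_ge[of 0] V2_le[of 0] r_pos by linarith
    ultimately show "\<bar>V1 x\<bar> \<le> \<bar>\<bar>V1 0\<bar> + \<bar>S * x\<bar>\<bar>" by (simp add: abs_mult)
  qed
  \<comment> \<open>The n orthogonality conditions are linear equations in n + 1
    coefficients.\<close>
  obtain c where c: "\<exists>j\<in>{..n}. c j \<noteq> 0"
    and c0: "\<forall>i\<in>{..<n}. (\<Sum>j\<le>n. c j * E (\<lambda>x. x ^ j * gs i x)) = 0"
    using homogeneous_system_nontrivial_solution[of "{..<n}" "{..n}" "\<lambda>i j. E (\<lambda>x. x ^ j * gs i x)"] by auto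
  define p where "p = (\<Sum>j\<le>n. monom (c j) j)"
  have p_eval: "poly p x = (\<Sum>j\<le>n. c j * x ^ j)" for x
    by (simp add: p_def poly_sum poly_monom)
  have "degree p \<le> n"
    unfolding p_def by (intro degree_sum_le) (auto intro: order_trans[OF degree_monom_le])
  have "p \<noteq> 0"
  proof -
    obtain j where "j \<le> n" "c j \<noteq> 0" using c by auto
    moreover from \<open>j \<le> n\<close> have "coeff p j = c j" by (simp add: p_def coeff_sum)
    ultimately show ?thesis by auto
  qed
  have orth: "E (\<lambda>x. poly p x * gs i x) = 0" if "i < n" for i
  proof -
    have "integrable (mu V) (\<lambda>x. x ^ j * gs i x)" for j
      using gs[OF that] poly_growth_L2[of "\<lambda>x. x ^ j"]
      by (intro integrable_mult_of_squares) (auto simp: L2_def poly_growth_intros)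
    then have "E (\<lambda>x. \<Sum>j\<le>n. c j * (x ^ j * gs i x)) = (\<Sum>j\<le>n. c j * E (\<lambda>x. x ^ j * gs i x))" by simp
    then show ?thesis using c0 that by (simp add: p_eval sum_distrib_right mult.assoc)
  qed
  have p_pos: "0 < E (\<lambda>x. (poly p x)\<^sup>2)"
    using E_poly_square_nonzero[OF \<open>p \<noteq> 0\<close>] by (simp add: less_le)
  have graph: "(poly p, Lop V (poly p)) \<in> L_graph V"
    by (intro cutoff_L_graph smooth_poly V1_pg) (auto simp: deriv_poly poly_growth_poly)
  have energy: "E (\<lambda>x. poly p x * - Lop V (poly p) x) = E (\<lambda>x. (poly (pderiv p) x)\<^sup>2)"
  proof -
    have "poly_growth (Lop V (poly p))"
      unfolding Lop_def deriv_V deriv_poly by (intro poly_growth_intros V1_pg)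
    then show ?thesis using energy_identity[of "poly p"] by (simp add: deriv_poly poly_growth_poly smooth_poly)
  qed
  show "(INF fg \<in> {(f, g). (f, g) \<in> L_graph V \<and> E (\<lambda>x. (f x)\<^sup>2) \<noteq> 0 \<and>
      (\<forall>i<n. E (\<lambda>x. f x * gs i x) = 0)}. ereal (E (\<lambda>x. fst fg x * - snd fg x) / E (\<lambda>x. (fst fg x)\<^sup>2)))
      \<le> ereal (real n * S)"
  proof (rule INF_lower2)
    show "(poly p, Lop V (poly p)) \<in> {(f, g). (f, g) \<in> L_graph V \<and> E (\<lambda>x. (f x)\<^sup>2) \<noteq> 0 \<and>
      (\<forall>i<n. E (\<lambda>x. f x * gs i x) = 0)}"
      using graph p_pos orth by auto
    have "E (\<lambda>x. poly p x * - Lop V (poly p) x) / E (\<lambda>x. (poly p x)\<^sup>2) \<le> real n * S"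
      unfolding energy using poly_energy_le[OF V2_le V1_pg \<open>degree p \<le> n\<close>] p_pos
      by (simp add: pos_divide_le_eq)
    then show "ereal (E (\<lambda>x. fst (poly p, Lop V (poly p)) x * - snd (poly p, Lop V (poly p)) x)
        / E (\<lambda>x. (fst (poly p, Lop V (poly p)) x)\<^sup>2)) \<le> ereal (real n * S)" by simp
  qed
qed

end

theorem mainTheorem7:
  fixes V :: "real \<Rightarrow> real" and n :: nat
  assumes "smooth V"
    and "(INF x. ereal (deriv (deriv V) x)) > 0"
    and "n \<ge> 1"
  shows "ereal (real n) * (INF x. ereal (deriv (deriv V) x)) \<le> lambda_n V n
       \<and> lambda_n V n \<le> ereal (real n) * (SUP x. ereal (deriv (deriv V) x))"
proof -
  let ?V2 = "deriv (deriv V)"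
  have le_Inf: "(INF x. ereal (?V2 x)) \<le> ereal (?V2 x)" for x by (rule INF_lower) simp
  \<comment> \<open>The infimum is a real number: it is positive and at most the value of V'' at
    0.\<close>
  obtain r where r: "(INF x. ereal (?V2 x)) = ereal r"
    using assms(2) le_Inf[of 0] by (cases "INF x. ereal (?V2 x)") auto
  interpret uniformly_convex V "deriv V" ?V2 r
  proof
    show "0 < r" using assms(2) by (simp add: r)
    show "r \<le> ?V2 x" for x using le_Inf[of x] by (simp add: r)
  qed (intro smooth_has_deriv smooth_deriv assms)+
  have ge_Sup: "ereal (?V2 x) \<le> (SUP x. ereal (?V2 x))" for x by (rule SUP_upper) simp
  have "lambda_n V n \<le> ereal (real n) * (SUP x. ereal (?V2 x))"
  proof (cases "SUP x. ereal (?V2 x)")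
    case (real S)
    then have "?V2 x \<le> S" for x using ge_Sup[of x] by simp
    then show ?thesis using lambda_n_le[of S n] by (simp add: real)
  next
    \<comment> \<open>As n >= 1, the product n times infinity is infinity; in \<open>ereal\<close>
      it would be 0 for n = 0.\<close>
    case PInf
    then show ?thesis using assms(3) by simp
  next
    case MInf
    then show ?thesis using ge_Sup[of 0] by simp
  qed
  moreover have "ereal (real n) * (INF x. ereal (?V2 x)) \<le> lambda_n V n"
    using lambda_n_ge[of n] by (simp add: r)
  ultimately show ?thesis by blast
qed

end
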